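(* Let $\Gamma$ be a finite simplicial graph. Every finitely generated reflection subgroup of the right-angled Coxeter group $W_\Gamma$ is quasiconvex in $W_\Gamma$.
   Context: For a finite simplicial graph $\Gamma$, $W_\Gamma=\langle V(\Gamma)\mid s^2=1 \ (s\in V(\Gamma)),\ st=ts \text{ if } s,t \text{ are adjacent}\rangle$. A reflection in $W_\Gamma$ is an element of the form $wsw^{-1}$ with $s\in V(\Gamma)$ and $w\in W_\Gamma$. A reflection subgroup is a subgroup of $W_\Gamma$ generated by reflections. A subgroup $G<W_\Gamma$ is quasiconvex if there is $M\ge0$ such that every geodesic with endpoints in $G$ in the Cayley graph of $W_\Gamma$ with respect to the standard generating set $V(\Gamma)$ lies in the $M$-neighborhood of $G$. *)

theory Defs
  imports "Graph_Theory.Graph_Theory" "HOL-Algebra.Generated_Groups"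
begin

section \<open>Groups given by generators and relations\<close>

text \<open>A letter \<open>(x, b)\<close> stands for \<open>x\<close> if \<open>b\<close> is false and for the formal inverse of \<open>x\<close> if
  \<open>b\<close> is true. A relation \<open>l = r\<close> is the pair of words \<open>(l, r)\<close>.\<close>

type_synonym 'a word = "('a \<times> bool) list"

definition words :: "'a set \<Rightarrow> 'a word set" where
  "words S = lists (S \<times> UNIV)"

text \<open>The congruence on words over \<open>S\<close> generated by free cancellation and by the relations \<open>R\<close>.
  The classes of this relation are the elements of the group presented by \<open>S\<close> and \<open>R\<close>.\<close>

inductive_set pres_eq :: "'a set \<Rightarrow> ('a word \<times> 'a word) set \<Rightarrow> ('a word \<times> 'a word) set"
  for S R where
    refl: "w \<in> words S \<Longrightarrow> (w, w) \<in> pres_eq S R"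
  | sym: "(v, w) \<in> pres_eq S R \<Longrightarrow> (w, v) \<in> pres_eq S R"
  | trans: "(u, v) \<in> pres_eq S R \<Longrightarrow> (v, w) \<in> pres_eq S R \<Longrightarrow> (u, w) \<in> pres_eq S R"
  | cancel: "u \<in> words S \<Longrightarrow> v \<in> words S \<Longrightarrow> x \<in> S
      \<Longrightarrow> (u @ [(x, b), (x, \<not> b)] @ v, u @ v) \<in> pres_eq S R"
  | relation: "u \<in> words S \<Longrightarrow> v \<in> words S \<Longrightarrow> (l, r) \<in> R \<Longrightarrow> l \<in> words S \<Longrightarrow> r \<in> words S
      \<Longrightarrow> (u @ l @ v, u @ r @ v) \<in> pres_eq S R"

definition presented_group :: "'a set \<Rightarrow> ('a word \<times> 'a word) set \<Rightarrow> 'a word set monoid" where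
  "presented_group S R =
    \<lparr>carrier = words S // pres_eq S R,
     mult = (\<lambda>A B. \<Union>a\<in>A. \<Union>b\<in>B. pres_eq S R `` {a @ b}),
     one = pres_eq S R `` {[]}\<rparr>"

definition pres_gen :: "'a set \<Rightarrow> ('a word \<times> 'a word) set \<Rightarrow> 'a \<Rightarrow> 'a word set" where
  "pres_gen S R x = pres_eq S R `` {[(x, False)]}"

lemma words_append [simp]: "u @ v \<in> words S \<longleftrightarrow> u \<in> words S \<and> v \<in> words S"
  by (auto simp: words_def)

lemma words_Nil [simp]: "[] \<in> words S"
  by (simp add: words_def)

lemma words_Cons [simp]: "(x, b) # w \<in> words S \<longleftrightarrow> x \<in> S \<and> w \<in> words S"
  by (auto simp: words_def)

lemma pres_eq_words:
  "(v, w) \<in> pres_eq S R \<Longrightarrow> v \<in> words S \<and> w \<in> words S"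
  by (induction rule: pres_eq.induct) auto

lemma equiv_pres_eq: "equiv (words S) (pres_eq S R)"
proof (rule equivI)
  show "pres_eq S R \<subseteq> words S \<times> words S"
    using pres_eq_words by fastforce
  show "refl_on (words S) (pres_eq S R)"
    by (simp add: refl_on_def pres_eq.refl)
  show "Relation.sym (pres_eq S R)"
    by (rule symI) (rule pres_eq.sym)
  show "Relation.trans (pres_eq S R)"
    by (rule transI) (rule pres_eq.trans)
qed

lemma pres_eq_context:
  "(v, w) \<in> pres_eq S R \<Longrightarrow> p \<in> words S \<Longrightarrow> q \<in> words S \<Longrightarrow> (p @ v @ q, p @ w @ q) \<in> pres_eq S R"
proof (induction rule: pres_eq.induct)
  case (refl w)
  then show ?case by (intro pres_eq.refl) auto
next
  case (sym v w)
  then show ?case by (blast intro: pres_eq.sym)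
next
  case (trans u v w)
  then show ?case by (blast intro: pres_eq.trans)
next
  case (cancel u v x b)
  then show ?case
    using pres_eq.cancel[of "p @ u" S "v @ q" x b R] by simp
next
  case (relation u v l r)
  then show ?case
    using pres_eq.relation[of "p @ u" S "v @ q" l r R] by simp
qed

lemma pres_eq_append:
  assumes "(a, a') \<in> pres_eq S R" "(b, b') \<in> pres_eq S R"
  shows "(a @ b, a' @ b') \<in> pres_eq S R"
  using pres_eq_context[OF assms(1), of "[]" b] pres_eq_context[OF assms(2), of a' "[]"]
    pres_eq_words[OF assms(1)] pres_eq_words[OF assms(2)]
  by (auto intro: pres_eq.trans)

lemma presented_group_mult:
  assumes "a \<in> words S" "b \<in> words S"
  shows "pres_eq S R `` {a} \<otimes>\<^bsub>presented_group S R\<^esub> pres_eq S R `` {b} = pres_eq S R `` {a @ b}"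
proof -
  have "congruent2 (pres_eq S R) (pres_eq S R) (\<lambda>a b. pres_eq S R `` {a @ b})"
    by (rule congruent2I') (use equiv_class_eq[OF equiv_pres_eq] pres_eq_append in blast)
  from UN_equiv_class2[OF equiv_pres_eq equiv_pres_eq this assms]
  show ?thesis by (simp add: presented_group_def)
qed

definition word_inv :: "'a word \<Rightarrow> 'a word" where
  "word_inv w = rev (map (\<lambda>(x, b). (x, \<not> b)) w)"

lemma word_inv_words: "w \<in> words S \<Longrightarrow> word_inv w \<in> words S"
  by (induction w) (auto simp: word_inv_def)

lemma word_inv_left:
  "w \<in> words S \<Longrightarrow> (word_inv w @ w, []) \<in> pres_eq S R"
proof (induction w)
  case Nil
  then show ?case by (simp add: word_inv_def pres_eq.refl)
next
  case (Cons l w)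
  obtain x b where l: "l = (x, b)" by (cases l)
  have w: "w \<in> words S" "x \<in> S" using Cons.prems l by auto
  have "(word_inv w @ [(x, \<not> b), (x, \<not> \<not> b)] @ w, word_inv w @ w) \<in> pres_eq S R"
    by (rule pres_eq.cancel) (use w word_inv_words in auto)
  also have "word_inv w @ [(x, \<not> b), (x, \<not> \<not> b)] @ w = word_inv (l # w) @ l # w"
    by (simp add: word_inv_def l)
  finally show ?case using Cons.IH[OF w(1)] by (rule pres_eq.trans)
qed

lemma group_presented_group: "group (presented_group S R)"
proof -
  have car: "carrier (presented_group S R) = words S // pres_eq S R"
    and one: "\<one>\<^bsub>presented_group S R\<^esub> = pres_eq S R `` {[]}"
    by (simp_all add: presented_group_def)
  show ?thesis
  proof (rule groupI)
    fix x y
    assume "x \<in> carrier (presented_group S R)" "y \<in> carrier (presented_group S R)"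
    then show "x \<otimes>\<^bsub>presented_group S R\<^esub> y \<in> carrier (presented_group S R)"
      by (auto simp: car presented_group_mult elim!: quotientE intro!: quotientI)
  next
    show "\<one>\<^bsub>presented_group S R\<^esub> \<in> carrier (presented_group S R)"
      by (auto simp: car one intro: quotientI)
  next
    fix x y z
    assume "x \<in> carrier (presented_group S R)" "y \<in> carrier (presented_group S R)"
      "z \<in> carrier (presented_group S R)"
    then show "x \<otimes>\<^bsub>presented_group S R\<^esub> y \<otimes>\<^bsub>presented_group S R\<^esub> z
        = x \<otimes>\<^bsub>presented_group S R\<^esub> (y \<otimes>\<^bsub>presented_group S R\<^esub> z)"
      by (auto simp: car presented_group_mult elim!: quotientE)
  next
    fix x
    assume "x \<in> carrier (presented_group S R)"
    then show "\<one>\<^bsub>presented_group S R\<^esub> \<otimes>\<^bsub>presented_group S R\<^esub> x = x"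
      by (auto simp: car one presented_group_mult elim!: quotientE)
  next
    fix x
    assume "x \<in> carrier (presented_group S R)"
    then obtain w where w: "w \<in> words S" "x = pres_eq S R `` {w}"
      by (auto simp: car elim: quotientE)
    show "\<exists>y\<in>carrier (presented_group S R). y \<otimes>\<^bsub>presented_group S R\<^esub> x = \<one>\<^bsub>presented_group S R\<^esub>"
    proof
      show "pres_eq S R `` {word_inv w} \<in> carrier (presented_group S R)"
        by (simp add: car quotientI word_inv_words w)
      show "pres_eq S R `` {word_inv w} \<otimes>\<^bsub>presented_group S R\<^esub> x = \<one>\<^bsub>presented_group S R\<^esub>"
        by (simp add: w presented_group_mult word_inv_words one
            equiv_class_eq[OF equiv_pres_eq] word_inv_left)
    qed
  qed
qed

section \<open>Right-angled Coxeter groups\<close>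

text \<open>Below, \<open>\<Gamma>\<close> is meant to satisfy the locale predicate \<open>graph\<close>: finite, no loops, no multiple
  arcs, and symmetric, so that \<open>s \<rightarrow>\<^bsub>\<Gamma>\<^esub> t\<close> is adjacency of vertices.\<close>

definition racg_relations :: "('a, 'b) pre_digraph \<Rightarrow> ('a word \<times> 'a word) set" where
  "racg_relations \<Gamma> =
    {([(s, False), (s, False)], []) | s. s \<in> verts \<Gamma>} \<union>
    {([(s, False), (t, False)], [(t, False), (s, False)]) | s t. s \<rightarrow>\<^bsub>\<Gamma>\<^esub> t}"

definition racg :: "('a, 'b) pre_digraph \<Rightarrow> 'a word set monoid" where
  "racg \<Gamma> = presented_group (verts \<Gamma>) (racg_relations \<Gamma>)"

definition racg_gen :: "('a, 'b) pre_digraph \<Rightarrow> 'a \<Rightarrow> 'a word set" where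
  "racg_gen \<Gamma> = pres_gen (verts \<Gamma>) (racg_relations \<Gamma>)"

definition reflections :: "('a, 'b) pre_digraph \<Rightarrow> 'a word set set" where
  "reflections \<Gamma> =
    {w \<otimes>\<^bsub>racg \<Gamma>\<^esub> racg_gen \<Gamma> s \<otimes>\<^bsub>racg \<Gamma>\<^esub> inv\<^bsub>racg \<Gamma>\<^esub> w | w s.
      w \<in> carrier (racg \<Gamma>) \<and> s \<in> verts \<Gamma>}"

definition reflection_subgroup :: "('a, 'b) pre_digraph \<Rightarrow> 'a word set set \<Rightarrow> bool" where
  "reflection_subgroup \<Gamma> H \<longleftrightarrow> (\<exists>T \<subseteq> reflections \<Gamma>. H = generate (racg \<Gamma>) T)"

definition finitely_generated_subgroup :: "('g, 'm) monoid_scheme \<Rightarrow> 'g set \<Rightarrow> bool" where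
  "finitely_generated_subgroup G H \<longleftrightarrow>
    (\<exists>A. finite A \<and> A \<subseteq> carrier G \<and> H = generate G A)"

lemma group_racg: "group (racg \<Gamma>)"
  by (simp add: racg_def group_presented_group)

section \<open>Quasiconvexity\<close>

text \<open>The undirected Cayley graph: each edge is represented by its two orientations.\<close>

definition cayley_graph :: "('g, 'm) monoid_scheme \<Rightarrow> 'g set \<Rightarrow> ('g, 'g \<times> 'g) pre_digraph" where
  "cayley_graph G S =
    \<lparr>verts = carrier G,
     arcs = {(g, h). g \<in> carrier G \<and> h \<in> carrier G \<and>
       (\<exists>s\<in>S. h = g \<otimes>\<^bsub>G\<^esub> s \<or> g = h \<otimes>\<^bsub>G\<^esub> s)},
     tail = fst,
     head = snd\<rparr>"

lemma wf_digraph_cayley_graph: "wf_digraph (cayley_graph G S)"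
  by unfold_locales (auto simp: cayley_graph_def)

definition graph_dist :: "('v, 'e) pre_digraph \<Rightarrow> 'v \<Rightarrow> 'v \<Rightarrow> ereal" where
  "graph_dist X u v = wf_digraph.\<mu> X (\<lambda>_. 1) u v"

definition geodesic :: "('v, 'e) pre_digraph \<Rightarrow> 'v \<Rightarrow> 'e list \<Rightarrow> 'v \<Rightarrow> bool" where
  "geodesic X u p v \<longleftrightarrow>
    pre_digraph.awalk X u p v \<and> ereal (real (length p)) = graph_dist X u v"

text \<open>Only the vertices of a geodesic are required to lie near \<open>H\<close>. Points in the interior of an
  edge are within distance 1 of a vertex of that edge, so this only affects the constant \<open>M\<close>.\<close>

definition quasiconvex :: "('g, 'm) monoid_scheme \<Rightarrow> 'g set \<Rightarrow> 'g set \<Rightarrow> bool" where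
  "quasiconvex G S H \<longleftrightarrow>
    (\<exists>M::real. M \<ge> 0 \<and>
      (\<forall>u\<in>H. \<forall>v\<in>H. \<forall>p. geodesic (cayley_graph G S) u p v \<longrightarrow>
        (\<forall>x\<in>set (pre_digraph.awalk_verts (cayley_graph G S) u p).
          \<exists>h\<in>H. graph_dist (cayley_graph G S) x h \<le> ereal M)))"

end

theory Submission
  imports Defs
begin

text \<open>
  Each reflection \<open>r\<close> fixes a wall that cuts the Cayley graph into two halves, and \<open>g\<close> and \<open>h\<close> lie at
  distance equal to the number of walls between them. So a geodesic crosses no wall twice, and a point
  is near \<open>H\<close> as soon as few walls separate it from some element of \<open>H\<close>.

  Two facts about pairs of walls in the right-angled case carry the proof. If \<open>r\<close> and \<open>m\<close> commute and
  differ, then \<open>m\<close> preserves both sides of \<open>r\<close> (\<open>commuting_reflection_preserves_side\<close>). If they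
  do not commute, their walls are disjoint, so one of the four intersections of their sides is empty
  (\<open>empty_quadrant\<close>).

  A finitely generated reflection subgroup \<open>H\<close> is generated by finitely many of its reflections. Among
  all such finite sets take a set \<open>R\<close> whose walls are nearest to \<open>1\<close> in total. If a wall of \<open>R\<close> hid
  another one from \<open>1\<close>, reflecting the second in the first would bring it nearer; hence
  non-commuting members of \<open>R\<close> have disjoint far sides (\<open>facing_generators\<close>). A ping-pong argument
  then shows that every nontrivial element of \<open>H\<close> lies beyond the wall of some member of \<open>R\<close>
  (\<open>facing_separates\<close>).

  Let \<open>x\<close> be a point of a geodesic from \<open>u\<close> to \<open>v\<close>, with \<open>u, v \<in> H\<close>, and translate by \<open>H\<close> so that \<open>1\<close>
  is a nearest element of \<open>H\<close> to \<open>x\<close>. Then no wall of \<open>R\<close> separates \<open>1\<close> from \<open>x\<close>. A wall \<open>m\<close> that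
  separates \<open>1\<close> from \<open>x\<close> must also separate \<open>1\<close> from \<open>u\<close> or from \<open>v\<close>, say from \<open>u\<close>, since the
  geodesic cannot cross \<open>m\<close> twice.
  Let \<open>r \<in> R\<close> separate \<open>1\<close> from \<open>u\<close>. If \<open>r\<close> and \<open>m\<close> commute, replace \<open>u\<close> by the shorter \<open>r u\<close>, which is
  on the same side of \<open>m\<close>. Otherwise the points \<open>1\<close>, \<open>x\<close>, \<open>u\<close> occupy three of the four quadrants of \<open>m\<close>
  and \<open>r\<close>, and \<open>r\<close> itself, lying beyond its own wall, must be beyond \<open>m\<close> too
  (\<open>shared_wall_in_generator\<close>). So \<open>x\<close> is separated from \<open>1\<close> only by walls that separate \<open>1\<close> from some
  member of the finite set \<open>R\<close>, and the number of such walls does not depend on \<open>u\<close>, \<open>v\<close>, \<open>x\<close>.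
\<close>

section \<open>Groups generated by involutions\<close>

context group
begin

abbreviation wprod :: "'a list \<Rightarrow> 'a" where
  "wprod l \<equiv> foldr (\<otimes>) l \<one>"

lemma wprod_closed: "set l \<subseteq> carrier G \<Longrightarrow> wprod l \<in> carrier G"
  by (induction l) auto

lemma wprod_append:
  "set k \<subseteq> carrier G \<Longrightarrow> set l \<subseteq> carrier G \<Longrightarrow> wprod (k @ l) = wprod k \<otimes> wprod l"
  by (induction k) (auto simp: m_assoc wprod_closed)

lemma cancel_simps:
  assumes "x \<in> carrier G" "y \<in> carrier G"
  shows "x \<otimes> (inv x \<otimes> y) = y" "inv x \<otimes> (x \<otimes> y) = y"
  using assms by (simp_all flip: m_assoc)

lemma involution_cancel:
  assumes "s \<otimes> s = \<one>" "s \<in> carrier G" "y \<in> carrier G"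
  shows "s \<otimes> (s \<otimes> y) = y"
  using assms by (simp flip: m_assoc)

lemma generate_involutions:
  assumes R: "R \<subseteq> carrier G" and invol: "\<And>r. r \<in> R \<Longrightarrow> r \<otimes> r = \<one>"
  shows "generate G R = wprod ` lists R"
proof
  show "generate G R \<subseteq> wprod ` lists R"
  proof
    fix x assume "x \<in> generate G R"
    then show "x \<in> wprod ` lists R"
    proof induction
      case one
      show ?case by (rule image_eqI[of _ _ "[]"]) auto
    next
      case (incl h)
      then show ?case using R by (intro image_eqI[of _ _ "[h]"]) auto
    next
      case (inv h)
      then have "inv h = h" using R invol by (metis inv_equality subsetD)
      then show ?case using inv R by (intro image_eqI[of _ _ "[h]"]) auto
    next
      case (eng h k)
      then obtain a b where "a \<in> lists R" "b \<in> lists R" "h = wprod a" "k = wprod b" by blast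
      moreover have "set a \<subseteq> carrier G" "set b \<subseteq> carrier G" using calculation R by auto
      ultimately show ?case
        by (intro image_eqI[of _ _ "a @ b"]) (simp_all add: wprod_append del: foldr_append)
    qed
  qed
  have "wprod l \<in> generate G R" if "l \<in> lists R" for l
    using that by induction (auto intro: generate.one generate.incl generate.eng)
  then show "wprod ` lists R \<subseteq> generate G R" by blast
qed

lemma generate_finitary:
  assumes "x \<in> generate G T"
  shows "\<exists>F\<subseteq>T. finite F \<and> x \<in> generate G F"
  using assms
proof induction
  case one
  show ?case by (rule exI[of _ "{}"]) (auto intro: generate.one)
next
  case (incl h)
  then show ?case by (intro exI[of _ "{h}"]) (auto intro: generate.incl)
next
  case (inv h)
  then show ?case by (intro exI[of _ "{h}"]) (auto intro: generate.inv)
next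
  case (eng h k)
  then obtain A B where "A \<subseteq> T" "finite A" "h \<in> generate G A" "B \<subseteq> T" "finite B" "k \<in> generate G B"
    by blast
  moreover have "generate G A \<subseteq> generate G (A \<union> B)" "generate G B \<subseteq> generate G (A \<union> B)"
    by (simp_all add: mono_generate)
  ultimately show ?case
    by (intro exI[of _ "A \<union> B"]) (auto intro: generate.eng)
qed

text \<open>A finite generating set need not lie in a given one, but each of its elements is a word in finitely
  many of the given generators.\<close>

lemma finite_generators_among:
  assumes "T \<subseteq> carrier G" "finite A" "generate G A = generate G T"
  shows "\<exists>F\<subseteq>T. finite F \<and> generate G F = generate G T"
proof -
  have "\<forall>a\<in>A. \<exists>F\<subseteq>T. finite F \<and> a \<in> generate G F"
    using generate_finitary assms(3) generate.incl by metis
  then obtain f where f: "\<And>a. a \<in> A \<Longrightarrow> f a \<subseteq> T \<and> finite (f a) \<and> a \<in> generate G (f a)"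
    by metis
  define F where "F = \<Union> (f ` A)"
  have F: "F \<subseteq> T" "finite F" using f assms(2) by (auto simp: F_def)
  have "A \<subseteq> generate G F"
    using f mono_generate[of "f _" F] by (fastforce simp: F_def)
  then have "generate G A \<subseteq> generate G F"
    using F assms(1) by (intro generate_subgroup_incl generate_is_subgroup) auto
  moreover have "generate G F \<subseteq> generate G T" by (rule mono_generate[OF F(1)])
  ultimately show ?thesis using F assms(3) by auto
qed

end

section \<open>Walls\<close>

text \<open>\<open>N g\<close> is the set of reflections whose walls separate \<open>1\<close> from \<open>g\<close>, so two elements are on the same side
  of the wall of \<open>r\<close> iff both or neither of their sets contain \<open>r\<close>. The rule \<open>N_mult\<close> expresses
  \<open>N (g \<otimes> h)\<close> as the symmetric difference of \<open>N g\<close> and the \<open>g\<close>-conjugate of \<open>N h\<close>: follow a path from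
  \<open>1\<close> to \<open>g\<close>, then the translate by \<open>g\<close> of a path from \<open>1\<close> to \<open>h\<close>. The last assumption
  encodes that the group is right-angled: two generators commute or generate an infinite dihedral
  group, seen here through its action on the integers by the reflections at \<open>0\<close> and at \<open>1/2\<close>.\<close>

locale wall_group = group G for G (structure) +
  fixes S :: "'a set" and N :: "'a \<Rightarrow> 'a set"
  assumes S_carrier: "S \<subseteq> carrier G"
    and S_involution: "s \<in> S \<Longrightarrow> s \<otimes> s = \<one>"
    and S_generates: "generate G S = carrier G"
    and N_carrier: "N g \<subseteq> carrier G"
    and N_generator: "s \<in> S \<Longrightarrow> N s = {s}"
    and N_mult: "g \<in> carrier G \<Longrightarrow> h \<in> carrier G \<Longrightarrow> r \<in> carrier G \<Longrightarrow>
      r \<in> N (g \<otimes> h) \<longleftrightarrow> (r \<in> N g) \<noteq> (inv g \<otimes> r \<otimes> g \<in> N h)"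
    and infinite_dihedral: "a \<in> S \<Longrightarrow> s \<in> S \<Longrightarrow> a \<otimes> s \<noteq> s \<otimes> a \<Longrightarrow>
      \<exists>F :: 'a \<Rightarrow> int \<Rightarrow> int. (\<forall>g\<in>carrier G. \<forall>h\<in>carrier G. F (g \<otimes> h) = F g \<circ> F h) \<and>
        F a = uminus \<and> F s = (\<lambda>x. 1 - x)"
begin

definition refls :: "'a set" where
  "refls = {w \<otimes> s \<otimes> inv w | w s. w \<in> carrier G \<and> s \<in> S}"

lemma S_in_carrier [simp]: "s \<in> S \<Longrightarrow> s \<in> carrier G"
  using S_carrier by blast

lemma inv_S [simp]: "s \<in> S \<Longrightarrow> inv s = s"
  using S_involution inv_equality by simp

lemma N_in_carrier: "r \<in> N g \<Longrightarrow> r \<in> carrier G"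
  using N_carrier by blast

lemma word_exists:
  assumes "g \<in> carrier G"
  obtains l where "l \<in> lists S" "wprod l = g"
  using assms generate_involutions[OF S_carrier S_involution] S_generates by auto

lemma word_closed [simp]: "l \<in> lists S \<Longrightarrow> wprod l \<in> carrier G"
  using S_carrier by (intro wprod_closed) auto

lemma N_one [simp]: "N \<one> = {}"
proof -
  have "r \<notin> N \<one>" if "r \<in> carrier G" for r
    using N_mult[of \<one> \<one> r] that by simp
  then show ?thesis using N_in_carrier by blast
qed

lemma N_generator_mult:
  assumes "s \<in> S" "h \<in> carrier G" "r \<in> carrier G"
  shows "r \<in> N (s \<otimes> h) \<longleftrightarrow> (r = s) \<noteq> (s \<otimes> r \<otimes> s \<in> N h)"
  using N_mult[of s h r] assms by (simp add: N_generator)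

lemma N_inv:
  assumes "g \<in> carrier G" "r \<in> carrier G"
  shows "r \<in> N (inv g) \<longleftrightarrow> g \<otimes> r \<otimes> inv g \<in> N g"
  using N_mult[of "inv g" g r] assms by simp

lemma N_inv_mult:
  assumes "g \<in> carrier G" "h \<in> carrier G" "r \<in> carrier G"
  shows "r \<in> N (inv g \<otimes> h) \<longleftrightarrow> (g \<otimes> r \<otimes> inv g \<in> N g) \<noteq> (g \<otimes> r \<otimes> inv g \<in> N h)"
  using N_mult[of "inv g" h r] N_inv[of g r] assms by simp

text \<open>The walls between \<open>g\<close> and \<open>h\<close> are the \<open>g\<close>-translates of the walls between \<open>1\<close> and \<open>inv g \<otimes> h\<close>.\<close>

lemma N_cong_conj:
  assumes "g \<in> carrier G" "h \<in> carrier G" "r \<in> carrier G"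
  shows "(r \<in> N g) \<noteq> (r \<in> N h) \<longleftrightarrow> inv g \<otimes> r \<otimes> g \<in> N (inv g \<otimes> h)"
proof -
  have "g \<otimes> (inv g \<otimes> r \<otimes> g) \<otimes> inv g = r" using assms by (simp add: m_assoc cancel_simps)
  then show ?thesis using N_inv_mult[of g h "inv g \<otimes> r \<otimes> g"] assms by auto
qed

lemma conj_generator_twice:
  "s \<in> S \<Longrightarrow> r \<in> carrier G \<Longrightarrow> s \<otimes> (s \<otimes> r \<otimes> s) \<otimes> s = r"
  by (simp add: m_assoc involution_cancel S_involution)

lemma N_generator_mult_subset:
  assumes "s \<in> S" "h \<in> carrier G"
  shows "N (s \<otimes> h) \<subseteq> insert s ((\<lambda>r. s \<otimes> r \<otimes> s) ` N h)"
proof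
  fix r assume r: "r \<in> N (s \<otimes> h)"
  then have "r \<in> carrier G" by (rule N_in_carrier)
  then show "r \<in> insert s ((\<lambda>r. s \<otimes> r \<otimes> s) ` N h)"
    using r N_generator_mult[of s h r] conj_generator_twice[of s r] assms
    by (metis (no_types, lifting) image_eqI insertCI)
qed

lemma N_generator_mult_eq:
  assumes "s \<in> S" "h \<in> carrier G" "s \<notin> N h"
  shows "N (s \<otimes> h) = insert s ((\<lambda>r. s \<otimes> r \<otimes> s) ` N h)"
proof (rule equalityI[OF N_generator_mult_subset[OF assms(1,2)]], rule subsetI)
  have s: "s \<in> N (s \<otimes> h)"
    using N_generator_mult[of s h s] assms by (simp add: S_involution)
  fix r assume "r \<in> insert s ((\<lambda>r. s \<otimes> r \<otimes> s) ` N h)"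
  then consider "r = s" | q where "q \<in> N h" "r = s \<otimes> q \<otimes> s" by blast
  then show "r \<in> N (s \<otimes> h)"
  proof cases
    case 2
    then have q: "q \<in> carrier G" "s \<otimes> r \<otimes> s = q"
      using N_in_carrier conj_generator_twice assms(1) by auto
    have "r \<noteq> s"
    proof
      assume "r = s"
      then have "q = s" using q(2) assms(1) by (simp add: S_involution)
      then show False using 2 assms(3) by simp
    qed
    then show ?thesis using N_generator_mult[of s h r] q 2 assms by simp
  qed (simp add: s)
qed

lemma conj_refl:
  assumes "r \<in> refls" "g \<in> carrier G"
  shows "g \<otimes> r \<otimes> inv g \<in> refls"
proof -
  from assms obtain w t where w: "w \<in> carrier G" "t \<in> S" "r = w \<otimes> t \<otimes> inv w"
    by (auto simp: refls_def)
  then have "g \<otimes> r \<otimes> inv g = (g \<otimes> w) \<otimes> t \<otimes> inv (g \<otimes> w)"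
    using assms by (simp add: inv_mult_group m_assoc)
  then show ?thesis using w assms unfolding refls_def by blast
qed

lemma N_subset_refls:
  assumes "g \<in> carrier G"
  shows "finite (N g)" "N g \<subseteq> refls"
proof -
  have "finite (N (wprod l)) \<and> N (wprod l) \<subseteq> refls" if "l \<in> lists S" for l
    using that
  proof induction
    case Nil
    then show ?case by simp
  next
    case (Cons s l)
    let ?c = "\<lambda>r. s \<otimes> r \<otimes> s"
    have sub: "N (wprod (s # l)) \<subseteq> insert s (?c ` N (wprod l))"
      using N_generator_mult_subset Cons.hyps by simp
    have "?c r \<in> refls" if "r \<in> refls" for r
      using conj_refl[OF that, of s] Cons.hyps by simp
    moreover have "s \<in> refls" unfolding refls_def
      using Cons.hyps by (force intro: exI[of _ \<one>])
    ultimately show ?case using sub Cons.IH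
      by (auto intro: finite_subset)
  qed
  moreover obtain l where "l \<in> lists S" "wprod l = g" by (rule word_exists[OF assms])
  ultimately show "finite (N g)" "N g \<subseteq> refls" by auto
qed

lemma refls_carrier: "refls \<subseteq> carrier G"
  by (auto simp: refls_def)

lemma refl_involution:
  assumes "r \<in> refls"
  shows "r \<otimes> r = \<one>"
proof -
  from assms obtain w s where "w \<in> carrier G" "s \<in> S" "r = w \<otimes> s \<otimes> inv w"
    by (auto simp: refls_def)
  then show ?thesis by (simp add: m_assoc cancel_simps involution_cancel S_involution)
qed

text \<open>A path from \<open>1\<close> that crosses the wall of \<open>r\<close> can be folded along that wall: the part before one
  crossing edge stays, the edge is deleted, and the rest is reflected.\<close>

lemma exchange:
  assumes "l \<in> lists S" "r \<in> N (wprod l)"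
  shows "\<exists>k\<in>lists S. length l = Suc (length k) \<and> wprod k = r \<otimes> wprod l"
  using assms
proof (induction arbitrary: r)
  case Nil
  then show ?case by simp
next
  case (Cons s l)
  then have rc: "r \<in> carrier G" using N_in_carrier by blast
  show ?case
  proof (cases "r = s")
    case True
    then show ?thesis using Cons.hyps
      by (intro bexI[of _ l]) (simp_all add: involution_cancel S_involution)
  next
    case False
    then have "s \<otimes> r \<otimes> s \<in> N (wprod l)"
      using N_generator_mult[of s "wprod l" r] Cons.hyps Cons.prems rc by simp
    then obtain k where k: "k \<in> lists S" "length l = Suc (length k)"
        "wprod k = s \<otimes> r \<otimes> s \<otimes> wprod l"
      using Cons.IH by blast
    then show ?thesis using Cons.hyps rc
      by (intro bexI[of _ "s # k"]) (simp_all add: m_assoc involution_cancel S_involution)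
  qed
qed

lemma card_N_generator_mult:
  assumes "s \<in> S" "h \<in> carrier G"
  shows "card (N (s \<otimes> h)) \<le> Suc (card (N h))"
proof -
  have fin: "finite (N h)" using N_subset_refls(1) assms by simp
  have "card (N (s \<otimes> h)) \<le> card (insert s ((\<lambda>r. s \<otimes> r \<otimes> s) ` N h))"
    using N_generator_mult_subset[OF assms] fin by (intro card_mono) auto
  also have "\<dots> \<le> Suc (card (N h))"
    using card_image_le[OF fin, of "\<lambda>r. s \<otimes> r \<otimes> s"] fin by (simp add: card_insert_if)
  finally show ?thesis .
qed

lemma card_N_le_length:
  assumes "l \<in> lists S"
  shows "card (N (wprod l)) \<le> length l"
  using assms
proof induction
  case Nil
  then show ?case by simp
next
  case (Cons s l)
  then show ?case using card_N_generator_mult[of s "wprod l"] by simp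
qed

lemma conj_inj_on: "g \<in> carrier G \<Longrightarrow> inj_on (\<lambda>r. g \<otimes> r \<otimes> inv g) (carrier G)"
  by (rule inj_onI) simp

text \<open>In a shortest word no wall is crossed twice, for otherwise the exchange property would shorten it. So
  word length counts separating walls, and the cardinality of \<open>N g\<close> serves as the length of \<open>g\<close>
  throughout.\<close>

lemma reduced_word:
  assumes g: "g \<in> carrier G"
  obtains l where "l \<in> lists S" "wprod l = g" "length l = card (N g)"
proof -
  define shortest where "shortest l \<longleftrightarrow> (\<forall>k\<in>lists S. wprod k = wprod l \<longrightarrow> length l \<le> length k)"
    for l
  have *: "length l = card (N (wprod l))" if "l \<in> lists S" "shortest l" for l
    using that
  proof induction
    case Nil
    then show ?case by simp
  next
    case (Cons s l)
    let ?c = "\<lambda>r. s \<otimes> r \<otimes> s"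
    have "shortest l" unfolding shortest_def
    proof (intro ballI impI)
      fix k assume "k \<in> lists S" "wprod k = wprod l"
      then show "length l \<le> length k"
        using Cons.prems Cons.hyps unfolding shortest_def
        by (auto dest!: bspec[of _ _ "s # k"])
    qed
    then have len: "length l = card (N (wprod l))" using Cons.IH by simp
    have "s \<notin> N (wprod l)"
    proof
      assume "s \<in> N (wprod l)"
      then obtain k where "k \<in> lists S" "length l = Suc (length k)" "wprod k = s \<otimes> wprod l"
        using exchange Cons.hyps by blast
      then show False using Cons.prems unfolding shortest_def by fastforce
    qed
    then have "N (s \<otimes> wprod l) = insert s (?c ` N (wprod l))"
      using N_generator_mult_eq Cons.hyps by simp
    moreover have "s \<notin> ?c ` N (wprod l)"
    proof
      assume "s \<in> ?c ` N (wprod l)"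
      then obtain q where q: "q \<in> N (wprod l)" "s \<otimes> q \<otimes> s = s" by auto
      then have "q = s" using conj_generator_twice[of s q] Cons.hyps N_in_carrier
        by (simp add: S_involution)
      then show False using q \<open>s \<notin> N (wprod l)\<close> by simp
    qed
    moreover have "inj_on ?c (N (wprod l))"
      using conj_inj_on[of s] Cons.hyps N_carrier by (metis inj_on_subset inv_S S_in_carrier)
    ultimately show ?case using len N_subset_refls(1) Cons.hyps
      by (simp add: card_image)
  qed
  obtain l0 where "l0 \<in> lists S \<and> wprod l0 = g" using word_exists[OF g] by metis
  then obtain l where l: "l \<in> lists S \<and> wprod l = g"
      "\<And>k. k \<in> lists S \<and> wprod k = g \<Longrightarrow> length l \<le> length k"
    using ex_has_least_nat[of "\<lambda>l. l \<in> lists S \<and> wprod l = g" l0 length] by metis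
  then have "shortest l" unfolding shortest_def by simp
  then show ?thesis using that[of l] *[of l] l(1) by simp
qed

lemma card_N_reflect:
  assumes "r \<in> N g" "g \<in> carrier G"
  shows "card (N (r \<otimes> g)) < card (N g)"
proof -
  obtain l where l: "l \<in> lists S" "wprod l = g" "length l = card (N g)"
    using reduced_word assms by blast
  then obtain k where "k \<in> lists S" "length l = Suc (length k)" "wprod k = r \<otimes> g"
    using exchange assms by blast
  then show ?thesis using card_N_le_length[of k] l by simp
qed

lemma card_N_inv_mult:
  assumes "g \<in> carrier G" "h \<in> carrier G"
  shows "card (N (inv g \<otimes> h)) = card (sym_diff (N g) (N h))"
proof -
  let ?c = "\<lambda>r. g \<otimes> r \<otimes> inv g"
  have "?c ` N (inv g \<otimes> h) = sym_diff (N g) (N h)"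
  proof (intro equalityI subsetI)
    fix r assume "r \<in> ?c ` N (inv g \<otimes> h)"
    then obtain q where q: "q \<in> N (inv g \<otimes> h)" "r = ?c q" by auto
    then show "r \<in> sym_diff (N g) (N h)"
      using iffD1[OF N_inv_mult[OF assms N_in_carrier[OF q(1)]] q(1)] unfolding q(2) by blast
  next
    fix r assume r: "r \<in> sym_diff (N g) (N h)"
    then have rc: "r \<in> carrier G" using N_carrier[of g] N_carrier[of h] by blast
    have "inv g \<otimes> r \<otimes> g \<in> N (inv g \<otimes> h)" 
      using iffD1[OF N_cong_conj[OF assms rc]] r by blast
    moreover have "?c (inv g \<otimes> r \<otimes> g) = r" using assms rc by (simp add: m_assoc cancel_simps)
    ultimately show "r \<in> ?c ` N (inv g \<otimes> h)" by (metis image_eqI)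
  qed
  moreover have "inj_on ?c (N (inv g \<otimes> h))"
    using conj_inj_on[OF assms(1)] N_carrier by (metis inj_on_subset)
  ultimately show ?thesis by (metis card_image)
qed

lemma first_letter:
  assumes "g \<in> carrier G" "g \<noteq> \<one>"
  obtains s where "s \<in> S" "s \<in> N g"
proof -
  obtain l where l: "l \<in> lists S" "wprod l = g" "length l = card (N g)"
    using reduced_word assms by blast
  then obtain s k where k: "l = s # k" using assms by (cases l) auto
  have "s \<in> N g"
  proof (rule ccontr)
    assume "s \<notin> N g"
    then have "s \<in> N (wprod k)"
      using N_generator_mult[of s "wprod k" s] l k by (auto simp: S_involution)
    then have "card (N g) < card (N (wprod k))"
      using card_N_reflect[of s "wprod k"] l k by simp
    then show False using card_N_le_length[of k] l k by simp
  qed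
  then show ?thesis using that[of s] l k by simp
qed

section \<open>Pairs of walls\<close>

lemma reflection_crosses_own_wall:
  assumes "r \<in> refls"
  shows "r \<in> N r"
proof -
  from assms obtain w s where w: "w \<in> carrier G" "s \<in> S" "r = w \<otimes> s \<otimes> inv w"
    by (auto simp: refls_def)
  have conj: "inv w \<otimes> r \<otimes> w = s" "inv (w \<otimes> s) \<otimes> r \<otimes> (w \<otimes> s) = s"
    using w by (simp_all add: m_assoc cancel_simps inv_mult_group involution_cancel S_involution)
  have rc: "r \<in> carrier G" using assms refls_carrier by blast
  have "r \<in> N (w \<otimes> s) \<longleftrightarrow> r \<notin> N w"
    using N_mult[of w s r] w(1,2) rc conj by (simp add: N_generator)
  moreover have "s \<in> N (inv w) \<longleftrightarrow> r \<in> N w"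
    using N_inv[of w s] w by simp
  moreover have "r \<in> N r \<longleftrightarrow> (r \<in> N (w \<otimes> s)) \<noteq> (s \<in> N (inv w))"
    using N_mult[of "w \<otimes> s" "inv w" r] w(1,2) rc conj unfolding w(3)[symmetric] by simp
  ultimately show ?thesis by blast
qed

text \<open>Conjugating \<open>m\<close> to a generator \<open>s\<close> turns \<open>r\<close> into a reflection \<open>q\<close> that commutes with \<open>s\<close> and differs
  from it. A single edge labelled \<open>s\<close> crosses only the wall of \<open>s\<close>. The two translated
  paths that lead to and from this edge cross the wall of \<open>r\<close> equally often, so their
  contributions cancel.\<close>

lemma commuting_wall_not_crossed:
  assumes "r \<in> refls" "m \<in> refls" "r \<otimes> m = m \<otimes> r" "r \<noteq> m"
  shows "r \<notin> N m"
proof -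
  from assms obtain w s where w: "w \<in> carrier G" "s \<in> S" "m = w \<otimes> s \<otimes> inv w"
    by (auto simp: refls_def)
  have rc: "r \<in> carrier G" using assms refls_carrier by blast
  define q where "q = inv w \<otimes> r \<otimes> w"
  have qc: "q \<in> carrier G" using w rc by (simp add: q_def)
  have r: "r = w \<otimes> q \<otimes> inv w"
    using w rc by (simp add: q_def m_assoc cancel_simps)
  have "w \<otimes> (q \<otimes> s) \<otimes> inv w = r \<otimes> m" "w \<otimes> (s \<otimes> q) \<otimes> inv w = m \<otimes> r"
    using w qc unfolding r w(3) by (simp_all add: m_assoc cancel_simps)
  then have "w \<otimes> (q \<otimes> s) \<otimes> inv w = w \<otimes> (s \<otimes> q) \<otimes> inv w" using assms(3) by simp
  then have "q \<otimes> s = s \<otimes> q" using w(1,2) qc by simp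
  then have "s \<otimes> q \<otimes> s = q \<otimes> s \<otimes> s" by simp
  also have "\<dots> = q" using w(2) qc by (simp add: m_assoc S_involution)
  finally have sqs: "s \<otimes> q \<otimes> s = q" .
  have "q \<noteq> s" using assms(4) unfolding r w(3) by auto
  then have "q \<notin> N s" by (simp add: N_generator w(2))
  then have 1: "r \<in> N (w \<otimes> s) \<longleftrightarrow> r \<in> N w"
    using N_mult[OF w(1) S_in_carrier[OF w(2)] rc] unfolding q_def by blast
  have "inv (w \<otimes> s) \<otimes> r \<otimes> (w \<otimes> s) = s \<otimes> q \<otimes> s"
    unfolding q_def using w(1,2) rc by (simp add: m_assoc inv_mult_group)
  then have "inv (w \<otimes> s) \<otimes> r \<otimes> (w \<otimes> s) = q" unfolding sqs .
  then have "r \<in> N (w \<otimes> s \<otimes> inv w) \<longleftrightarrow> (r \<in> N (w \<otimes> s)) \<noteq> (q \<in> N (inv w))"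
    using N_mult[OF m_closed[OF w(1) S_in_carrier[OF w(2)]] inv_closed[OF w(1)] rc] by (simp only:)
  moreover have "q \<in> N (inv w) \<longleftrightarrow> r \<in> N w"
    using N_inv[OF w(1) qc] unfolding r .
  ultimately show ?thesis unfolding w(3) using 1 by simp
qed

lemma commuting_reflection_preserves_side:
  assumes "r \<in> refls" "m \<in> refls" "r \<otimes> m = m \<otimes> r" "r \<noteq> m" "y \<in> carrier G"
  shows "r \<in> N (m \<otimes> y) \<longleftrightarrow> r \<in> N y"
proof -
  have c: "r \<in> carrier G" "m \<in> carrier G" using assms refls_carrier by blast+
  have "m \<otimes> m = \<one>" using refl_involution assms(2) .
  then have "inv m = m" using c inv_equality by blast
  then have "inv m \<otimes> r \<otimes> m = r \<otimes> (m \<otimes> m)" using assms(3) c by (simp add: m_assoc[symmetric])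
  then have "inv m \<otimes> r \<otimes> m = r" using \<open>m \<otimes> m = \<one>\<close> c by simp
  then show ?thesis
    using N_mult[of m y r] commuting_wall_not_crossed[OF assms(1-4)] c assms(5) by simp
qed

primrec alternating :: "nat \<Rightarrow> 'a \<Rightarrow> 'a \<Rightarrow> 'a" where
  "alternating 0 a s = \<one>"
| "alternating (Suc n) a s = a \<otimes> alternating n s a"

lemma alternating_closed [simp]:
  "a \<in> S \<Longrightarrow> s \<in> S \<Longrightarrow> alternating n a s \<in> carrier G"
  by (induction n arbitrary: a s) auto

text \<open>In the action on the integers, a path \<open>1, a, a s, \<dots>\<close> moves away from the interval between \<open>0\<close> and
  \<open>1/2\<close> to the left and crosses only mirrors \<open>c/2\<close> with \<open>c \<le> 0\<close>; starting with \<open>s\<close> it crosses only those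
  with \<open>c \<ge> 1\<close>. The two claims feed each other in the induction, because stripping the first letter
  swaps the roles of \<open>a\<close> and \<open>s\<close>.\<close>

lemma alternating_one_descent:
  assumes S: "a \<in> S" "s \<in> S" and non: "a \<otimes> s \<noteq> s \<otimes> a"
  shows "s \<notin> N (alternating n a s)"
proof -
  obtain F :: "'a \<Rightarrow> int \<Rightarrow> int"
    where mult: "\<And>g h. g \<in> carrier G \<Longrightarrow> h \<in> carrier G \<Longrightarrow> F (g \<otimes> h) = F g \<circ> F h"
      and Fa: "F a = uminus" and Fs: "F s = (\<lambda>x. 1 - x)"
    using infinite_dihedral[OF S non] by metis
  have aa: "F (a \<otimes> q \<otimes> a) = (\<lambda>x. - F q (- x))" if "q \<in> carrier G" for q
    using S that by (simp add: mult Fa fun_eq_iff)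
  have ss: "F (s \<otimes> q \<otimes> s) = (\<lambda>x. 1 - F q (1 - x))" if "q \<in> carrier G" for q
    using S that by (simp add: mult Fs fun_eq_iff)
  have "(\<forall>z\<in>N (alternating n a s). \<exists>c\<le>0. F z = (\<lambda>x. c - x)) \<and>
        (\<forall>z\<in>N (alternating n s a). \<exists>c\<ge>1. F z = (\<lambda>x. c - x))"
  proof (induction n)
    case 0
    then show ?case by simp
  next
    case (Suc n)
    have "\<exists>c\<le>0. F z = (\<lambda>x. c - x)" if z: "z \<in> N (alternating (Suc n) a s)" for z
    proof -
      have "z \<in> insert a ((\<lambda>r. a \<otimes> r \<otimes> a) ` N (alternating n s a))"
        using N_generator_mult_subset[of a "alternating n s a"] z S by auto
      then consider "z = a" | q where "q \<in> N (alternating n s a)" "z = a \<otimes> q \<otimes> a" by blast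
      then show ?thesis
      proof cases
        case 1
        then show ?thesis by (intro exI[of _ 0]) (simp add: Fa fun_eq_iff)
      next
        case 2
        then obtain c where "c \<ge> 1" "F q = (\<lambda>x. c - x)" using Suc by blast
        then show ?thesis using aa[of q] 2 N_in_carrier
          by (intro exI[of _ "- c"]) (simp add: fun_eq_iff)
      qed
    qed
    moreover have "\<exists>c\<ge>1. F z = (\<lambda>x. c - x)" if z: "z \<in> N (alternating (Suc n) s a)" for z
    proof -
      have "z \<in> insert s ((\<lambda>r. s \<otimes> r \<otimes> s) ` N (alternating n a s))"
        using N_generator_mult_subset[of s "alternating n a s"] z S by auto
      then consider "z = s" | q where "q \<in> N (alternating n a s)" "z = s \<otimes> q \<otimes> s" by blast
      then show ?thesis
      proof cases
        case 1
        then show ?thesis by (intro exI[of _ 1]) (simp add: Fs)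
      next
        case 2
        then obtain c where "c \<le> 0" "F q = (\<lambda>x. c - x)" using Suc by blast
        then show ?thesis using ss[of q] 2 N_in_carrier
          by (intro exI[of _ "2 - c"]) (simp add: fun_eq_iff)
      qed
    qed
    ultimately show ?case by blast
  qed
  moreover have "F s \<noteq> (\<lambda>x. c - x)" if "c \<le> 0" for c
  proof
    assume "F s = (\<lambda>x. c - x)"
    then have "F s 0 = c - 0" by simp
    then show False using that by (simp add: Fs)
  qed
  ultimately show ?thesis by blast
qed

text \<open>Write \<open>w = d \<otimes> u\<close> with \<open>d\<close> in the dihedral group generated by \<open>a\<close> and \<open>s\<close> and \<open>u\<close> as short as
  possible. Then no reflection conjugate to \<open>a\<close> or \<open>s\<close> in that group separates \<open>1\<close> from \<open>u\<close>, so both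
  walls would already separate \<open>1\<close> from \<open>d\<close>. That is impossible when the dihedral group is infinite.\<close>

lemma initial_letters_commute:
  assumes S: "a \<in> S" "s \<in> S" and w: "w \<in> carrier G" and N: "a \<in> N w" "s \<in> N w"
  shows "a \<otimes> s = s \<otimes> a"
proof (rule ccontr)
  assume non: "a \<otimes> s \<noteq> s \<otimes> a"
  define D where "D = range (\<lambda>n. alternating n a s) \<union> range (\<lambda>n. alternating n s a)"
  have D_closed: "d \<in> carrier G" if "d \<in> D" for d using that S by (auto simp: D_def)
  have D_mult: "t \<otimes> d \<in> D" if t: "t \<in> {a, s}" and d: "d \<in> D" for t d
  proof -
    have *: "x \<otimes> alternating n x y \<in> D" "x \<otimes> alternating n y x \<in> D"
      if "{x, y} = {a, s}" for x y n
    proof -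
      have xy: "x \<in> S" "y \<in> S" "\<And>n. alternating n x y \<in> D" "\<And>n. alternating n y x \<in> D"
        using that S by (auto simp: D_def doubleton_eq_iff)
      show "x \<otimes> alternating n x y \<in> D"
      proof (cases n)
        case 0
        then show ?thesis using xy(3)[of 1] xy(1) by simp
      next
        case (Suc k)
        then show ?thesis using xy by (simp add: involution_cancel S_involution)
      qed
      show "x \<otimes> alternating n y x \<in> D" using xy(3)[of "Suc n"] by simp
    qed
    obtain n where "d = alternating n a s \<or> d = alternating n s a"
      using d by (auto simp: D_def)
    then show ?thesis using t *[of a s n] *[of s a n] by (auto simp: insert_commute)
  qed
  define P where "P u \<longleftrightarrow> u \<in> carrier G \<and> (\<exists>d\<in>D. w = d \<otimes> u)" for u
  have "P w" using w unfolding P_def D_def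
    by (auto intro!: bexI[of _ \<one>] image_eqI[of _ _ 0])
  then obtain u where u: "P u" and least: "\<And>v. P v \<Longrightarrow> card (N u) \<le> card (N v)"
    using ex_has_least_nat[of P w "\<lambda>u. card (N u)"] by metis
  then obtain d where d: "d \<in> D" "w = d \<otimes> u" and uc: "u \<in> carrier G" by (auto simp: P_def)
  have dc: "d \<in> carrier G" using D_closed d by blast
  \<comment> \<open>If \<open>t\<close> were not crossed by \<open>d\<close>, then \<open>q = inv d \<otimes> t \<otimes> d\<close> would be crossed by \<open>u\<close>, and
    \<open>w = (t \<otimes> d) \<otimes> (q \<otimes> u)\<close> would be a decomposition with a shorter second factor.\<close>
  have "t \<in> N d" if t: "t \<in> {a, s}" "t \<in> N w" for t
  proof (rule ccontr)
    assume "t \<notin> N d"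
    define q where "q = inv d \<otimes> t \<otimes> d"
    have tS: "t \<in> S" using t S by blast
    have q: "q \<in> N u"
      using N_mult[of d u t] dc uc tS t \<open>t \<notin> N d\<close> d by (simp add: q_def)
    have "t \<otimes> d \<otimes> (q \<otimes> u) = w"
      using dc uc tS unfolding q_def d(2)
      by (simp add: m_assoc cancel_simps involution_cancel S_involution)
    moreover have "q \<otimes> u \<in> carrier G" using q uc N_in_carrier by blast
    ultimately have "P (q \<otimes> u)" using D_mult[OF t(1) d(1)] unfolding P_def by metis
    then show False using least card_N_reflect[OF q uc] by fastforce
  qed
  then have "a \<in> N d" "s \<in> N d" using N by auto
  then show False
    using d(1) alternating_one_descent[OF S non] alternating_one_descent[OF S(2,1)] non
    unfolding D_def by auto
qed

text \<open>The edges \<open>{1, s}\<close> and \<open>{g, g t}\<close> cross the same wall. If \<open>a\<close> is a first letter of \<open>g\<close>, then both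
  \<open>a\<close> and \<open>s\<close> are first letters of \<open>s \<otimes> g\<close> and hence commute; so removing \<open>a\<close> leaves the situation
  unchanged. Thus everything between two edges of the wall of \<open>s\<close> commutes with \<open>s\<close>.\<close>

lemma gallery_along_wall:
  assumes "s \<in> S" "t \<in> S" "g \<in> carrier G" "g \<otimes> t = s \<otimes> g" "s \<notin> N g" "q \<in> N g"
  shows "q \<otimes> s = s \<otimes> q"
  using assms
proof (induction "card (N g)" arbitrary: g q rule: less_induct)
  case less
  note g = \<open>g \<in> carrier G\<close>
  have "g \<noteq> \<one>" using less.prems by auto
  then obtain a where a: "a \<in> S" "a \<in> N g" using first_letter g by blast
  have "a \<noteq> s" using a less.prems by blast
  define h where "h = a \<otimes> g"
  have h: "h \<in> carrier G" "g = a \<otimes> h"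
    using a g by (simp_all add: h_def involution_cancel S_involution)
  have card: "card (N h) < card (N g)" using card_N_reflect[OF a(2) g] by (simp add: h_def)
  have "s \<in> N (s \<otimes> g)"
    using N_generator_mult[of s g s] less.prems by (simp add: S_involution)
  moreover have "a \<in> N (s \<otimes> g)"
  proof -
    have "inv g \<otimes> a \<otimes> g \<noteq> t"
    proof
      assume "inv g \<otimes> a \<otimes> g = t"
      then have "g \<otimes> t = a \<otimes> g" using g a by (auto simp: m_assoc cancel_simps)
      then show False using less.prems a \<open>a \<noteq> s\<close> by simp
    qed
    then have "a \<in> N (g \<otimes> t)"
      using N_mult[of g t a] g a less.prems by (simp add: N_generator)
    then show ?thesis using less.prems by simp
  qed
  ultimately have as: "a \<otimes> s = s \<otimes> a"
    using initial_letters_commute[of a s "s \<otimes> g"] a g less.prems by simp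
  have asa: "a \<otimes> s \<otimes> a = s" using a less.prems(1) by (simp add: as m_assoc S_involution)
  have "h \<otimes> t = a \<otimes> (s \<otimes> g)" using a g less.prems by (simp add: h_def m_assoc)
  also have "\<dots> = s \<otimes> h" using as a g less.prems(1) by (simp add: h_def flip: m_assoc)
  finally have "h \<otimes> t = s \<otimes> h" .
  moreover have "s \<notin> N h"
    using N_generator_mult[of a h s] a h less.prems \<open>a \<noteq> s\<close> asa by auto
  ultimately have IH: "p \<otimes> s = s \<otimes> p" if "p \<in> N h" for p
    using less.hyps[OF card less.prems(1,2) h(1)] that by blast
  have "q \<in> insert a ((\<lambda>r. a \<otimes> r \<otimes> a) ` N h)"
    using N_generator_mult_subset[of a h] a h less.prems by auto
  then consider "q = a" | p where "p \<in> N h" "q = a \<otimes> p \<otimes> a" by blast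
  then show ?case
  proof cases
    case 2
    then have p: "p \<in> carrier G" "p \<otimes> s = s \<otimes> p" using IH N_in_carrier by blast+
    have "q \<otimes> s = a \<otimes> p \<otimes> (a \<otimes> s)" using 2 p a less.prems(1) by (simp add: m_assoc)
    also have "\<dots> = a \<otimes> (p \<otimes> s) \<otimes> a" using p(1) a less.prems(1) by (simp add: as m_assoc)
    also have "\<dots> = (a \<otimes> s) \<otimes> p \<otimes> a"
      unfolding p(2) using p(1) a less.prems(1) by (simp add: m_assoc)
    also have "\<dots> = s \<otimes> q" using 2 p a less.prems(1) by (simp add: as m_assoc)
    finally show ?thesis .
  qed (simp add: as)
qed

text \<open>If the far side of \<open>q\<close> contained \<open>y\<close> and \<open>z\<close> on different sides of \<open>s\<close>, a geodesic from \<open>y\<close> to \<open>z\<close>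
  would stay beyond \<open>q\<close> and traverse an edge crossing the wall of \<open>s\<close>. Then \<open>q\<close> separates that edge from
  the edge \<open>{1, s}\<close> of the same wall, and \<open>gallery_along_wall\<close> makes \<open>q\<close> and \<open>s\<close> commute.\<close>

lemma generator_quadrant:
  assumes "s \<in> S" "q \<in> refls" "q \<otimes> s \<noteq> s \<otimes> q"
    and "y \<in> carrier G" "z \<in> carrier G" "q \<in> N y" "s \<in> N y" "q \<in> N z"
  shows "s \<in> N z"
proof (rule ccontr)
  assume "s \<notin> N z"
  with assms(4-8) show False
  proof (induction "card (N (inv y \<otimes> z))" arbitrary: y rule: less_induct)
    case less
    note y = \<open>y \<in> carrier G\<close> and z = \<open>z \<in> carrier G\<close>
    have "inv y \<otimes> z \<noteq> \<one>"
      using less.prems y z by (metis inv_inv inv_closed inv_equality)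
    then obtain t where t: "t \<in> S" "t \<in> N (inv y \<otimes> z)"
      using first_letter y z by blast
    have side: "p \<in> N (y \<otimes> t)" if "p \<in> N y" "p \<noteq> y \<otimes> t \<otimes> inv y" for p
    proof -
      have p: "p \<in> carrier G" using that N_in_carrier by blast
      then have "inv y \<otimes> p \<otimes> y \<noteq> t" using that(2) y by (auto simp: m_assoc cancel_simps)
      then show ?thesis using N_mult[of y t p] that y t p by (simp add: N_generator)
    qed
    have "q \<noteq> y \<otimes> t \<otimes> inv y"
      using N_inv_mult[of y z t] t y z less.prems by auto
    then have q: "q \<in> N (y \<otimes> t)" using side less.prems by blast
    show False
    proof (cases "s = y \<otimes> t \<otimes> inv y")
      case True
      then have "y \<otimes> t = s \<otimes> y" using y t by (simp add: m_assoc)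
      moreover from this have "(y \<otimes> t) \<otimes> t = s \<otimes> (y \<otimes> t)"
        using y t assms(1) by (simp add: m_assoc S_involution involution_cancel)
      moreover have "s \<notin> N (s \<otimes> y)"
        using N_generator_mult[of s y s] assms(1) y less.prems by (simp add: S_involution)
      ultimately show False
        using gallery_along_wall[of s t "y \<otimes> t" q] assms(1,3) t y q by simp
    next
      case False
      then have "s \<in> N (y \<otimes> t)" using side less.prems by blast
      moreover have "inv (y \<otimes> t) \<otimes> z = t \<otimes> (inv y \<otimes> z)"
        using y z t by (simp add: inv_mult_group m_assoc)
      then have "card (N (inv (y \<otimes> t) \<otimes> z)) < card (N (inv y \<otimes> z))"
        using card_N_reflect[OF t(2)] y z by simp
      ultimately show False using less.hyps[of "y \<otimes> t"] q y z t less.prems by simp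
    qed
  qed
qed

text \<open>Walls of non-commuting reflections are disjoint. The signs \<open>\<epsilon>\<close>, \<open>\<delta>\<close> name the empty quadrant; which
  one it is depends on where \<open>1\<close> lies.\<close>

lemma empty_quadrant:
  assumes r: "r \<in> refls" and m: "m \<in> refls" and non: "r \<otimes> m \<noteq> m \<otimes> r"
  obtains \<epsilon> \<delta> where "\<And>y. y \<in> carrier G \<Longrightarrow> (r \<in> N y) = \<epsilon> \<Longrightarrow> (m \<in> N y) \<noteq> \<delta>"
proof -
  from m obtain w s where w: "w \<in> carrier G" "s \<in> S" "m = w \<otimes> s \<otimes> inv w"
    by (auto simp: refls_def)
  define q where "q = inv w \<otimes> r \<otimes> w"
  have rc: "r \<in> carrier G" using r refls_carrier by blast
  have qc: "q \<in> carrier G" using w rc by (simp add: q_def)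
  have r_eq: "r = w \<otimes> q \<otimes> inv w"
    using w rc by (simp add: q_def m_assoc cancel_simps)
  have q: "q \<in> refls" using conj_refl[OF r, of "inv w"] w by (simp add: q_def)
  have "q \<otimes> s \<noteq> s \<otimes> q"
  proof
    assume "q \<otimes> s = s \<otimes> q"
    moreover have "w \<otimes> (q \<otimes> s) \<otimes> inv w = r \<otimes> m" "w \<otimes> (s \<otimes> q) \<otimes> inv w = m \<otimes> r"
      using w qc unfolding r_eq w(3) by (simp_all add: m_assoc cancel_simps)
    ultimately show False using non by simp
  qed
  then obtain \<delta> where \<delta>: "\<And>y. y \<in> carrier G \<Longrightarrow> q \<in> N y \<Longrightarrow> (s \<in> N y) \<noteq> \<delta>"
    using generator_quadrant[OF w(2) q] by metis
  \<comment> \<open>Translation by \<open>inv w\<close> carries the sides of \<open>r\<close> and \<open>m\<close> to those of \<open>q\<close> and \<open>s\<close>; it swaps near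
    and far for each wall that separates \<open>1\<close> from \<open>w\<close>.\<close>
  have "(m \<in> N y) \<noteq> ((m \<in> N w) \<noteq> \<delta>)" if y: "y \<in> carrier G" "(r \<in> N y) = (r \<notin> N w)" for y
  proof -
    have "q \<in> N (inv w \<otimes> y)"
      using N_inv_mult[of w y q] w(1) y qc unfolding r_eq[symmetric] by auto
    then have "(s \<in> N (inv w \<otimes> y)) \<noteq> \<delta>" using \<delta> w y by simp
    then show ?thesis
      using N_inv_mult[of w y s] w(1,2) y unfolding w(3)[symmetric] by auto
  qed
  then show ?thesis using that by blast
qed

section \<open>Facing generators of a reflection subgroup\<close>

text \<open>The distance from \<open>1\<close> to the nearest edge crossing the wall of \<open>r\<close>: the edge from \<open>w\<close> to \<open>w \<otimes> s\<close>
  crosses the wall of \<open>w \<otimes> s \<otimes> inv w\<close>.\<close>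

definition depth :: "'a \<Rightarrow> nat" where
  "depth r = (LEAST n. \<exists>w\<in>carrier G. \<exists>s\<in>S. r = w \<otimes> s \<otimes> inv w \<and> card (N w) = n)"

lemma depth_le:
  "w \<in> carrier G \<Longrightarrow> s \<in> S \<Longrightarrow> depth (w \<otimes> s \<otimes> inv w) \<le> card (N w)"
  unfolding depth_def by (rule Least_le) blast

lemma depth_witness:
  assumes "r \<in> refls"
  obtains w s where "w \<in> carrier G" "s \<in> S" "r = w \<otimes> s \<otimes> inv w" "card (N w) = depth r" "r \<notin> N w"
proof -
  have "\<exists>n. \<exists>w\<in>carrier G. \<exists>s\<in>S. r = w \<otimes> s \<otimes> inv w \<and> card (N w) = n"
    using assms by (auto simp: refls_def)
  from LeastI_ex[OF this] obtain w s where
    w: "w \<in> carrier G" "s \<in> S" "r = w \<otimes> s \<otimes> inv w" "card (N w) = depth r"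
    unfolding depth_def by blast
  have "r \<notin> N w"
  proof
    assume "r \<in> N w"
    then have "card (N (r \<otimes> w)) < card (N w)" using card_N_reflect w(1) by simp
    moreover have "r \<otimes> w = w \<otimes> s" unfolding w(3) using w(1,2) by (simp add: m_assoc)
    moreover have "r = (w \<otimes> s) \<otimes> s \<otimes> inv (w \<otimes> s)"
      unfolding w(3) using w(1,2)
      by (simp add: inv_mult_group m_assoc involution_cancel S_involution)
    ultimately show False using depth_le[of "w \<otimes> s" s] w(1,2,4) by simp
  qed
  then show ?thesis using that w by blast
qed

text \<open>If everything beyond \<open>r\<close> is beyond \<open>m\<close>, the wall of \<open>m\<close> lies between \<open>1\<close> and the edge of \<open>r\<close> nearest
  to \<open>1\<close>, so reflecting that edge in \<open>m\<close> brings it nearer.\<close>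

lemma depth_reflect:
  assumes r: "r \<in> refls" and m: "m \<in> refls" and "r \<noteq> m"
    and nested: "\<And>y. y \<in> carrier G \<Longrightarrow> r \<in> N y \<Longrightarrow> m \<in> N y"
  shows "depth (m \<otimes> r \<otimes> m) < depth r"
proof -
  obtain w s where w: "w \<in> carrier G" "s \<in> S" "r = w \<otimes> s \<otimes> inv w" "card (N w) = depth r" "r \<notin> N w"
    using depth_witness[OF r] .
  have c: "r \<in> carrier G" "m \<in> carrier G" using r m refls_carrier by blast+
  have inv_m: "inv m = m" using refl_involution[OF m] c inv_equality by blast
  have conj: "inv w \<otimes> r \<otimes> w = s" unfolding w(3) using w(1,2) by (simp add: m_assoc cancel_simps)
  have "r \<in> N (w \<otimes> s)"
    using N_mult[OF w(1) S_in_carrier[OF w(2)] c(1)] w(5) unfolding conj N_generator[OF w(2)] by simp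
  then have "m \<in> N (w \<otimes> s)" using nested w by simp
  moreover have "inv w \<otimes> m \<otimes> w \<noteq> s"
  proof
    assume "inv w \<otimes> m \<otimes> w = s"
    then have "r = w \<otimes> (inv w \<otimes> m \<otimes> w) \<otimes> inv w" by (simp add: w(3))
    then show False using \<open>r \<noteq> m\<close> w(1) c by (simp add: m_assoc cancel_simps)
  qed
  ultimately have "m \<in> N w"
    using N_mult[OF w(1) S_in_carrier[OF w(2)] c(2)] unfolding N_generator[OF w(2)] by simp
  then have "card (N (m \<otimes> w)) < depth r" using card_N_reflect w by metis
  moreover have "m \<otimes> r \<otimes> m = (m \<otimes> w) \<otimes> s \<otimes> inv (m \<otimes> w)"
    unfolding w(3) using w(1,2) c by (simp add: inv_mult_group inv_m m_assoc)
  ultimately show ?thesis using depth_le[of "m \<otimes> w" s] w c by simp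
qed

text \<open>Walls of non-commuting members of \<open>R\<close> face each other: \<open>1\<close> lies between them, so their far sides are
  disjoint.\<close>

definition facing :: "'a set \<Rightarrow> bool" where
  "facing R \<longleftrightarrow> R \<subseteq> refls \<and>
    (\<forall>r\<in>R. \<forall>m\<in>R. \<forall>y\<in>carrier G. r \<in> N y \<and> m \<in> N y \<longrightarrow> r \<otimes> m = m \<otimes> r)"

lemma facingD:
  "facing R \<Longrightarrow> r \<in> R \<Longrightarrow> m \<in> R \<Longrightarrow> y \<in> carrier G \<Longrightarrow> r \<in> N y \<Longrightarrow> m \<in> N y \<Longrightarrow>
    r \<otimes> m = m \<otimes> r"
  unfolding facing_def by blast

lemma generate_reflect:
  assumes R: "R \<subseteq> refls" and r: "r \<in> R" and m: "m \<in> R" "m \<noteq> r"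
  shows "generate G (insert (m \<otimes> r \<otimes> m) (R - {r})) = generate G R"
proof -
  let ?Q = "insert (m \<otimes> r \<otimes> m) (R - {r})"
  have c: "R \<subseteq> carrier G" "r \<in> carrier G" "m \<in> carrier G" using R r m refls_carrier by blast+
  have mm: "m \<otimes> m = \<one>" using refl_involution R m by blast
  have "m \<otimes> r \<otimes> m \<in> generate G R"
    using r m by (intro generate.eng generate.incl)
  then have "?Q \<subseteq> generate G R" using generate.incl[of _ R G] by blast
  then have 1: "generate G ?Q \<subseteq> generate G R"
    by (rule generate_subgroup_incl[OF _ generate_is_subgroup[OF c(1)]])
  have "m \<otimes> (m \<otimes> r \<otimes> m) \<otimes> m \<in> generate G ?Q"
    using m by (intro generate.eng generate.incl) auto
  moreover have "m \<otimes> (m \<otimes> r \<otimes> m) \<otimes> m = r"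
    using c by (simp add: m_assoc involution_cancel mm)
  ultimately have "R \<subseteq> generate G ?Q" using generate.incl[of _ ?Q G] by auto
  moreover have "?Q \<subseteq> carrier G" using c by auto
  ultimately have "generate G R \<subseteq> generate G ?Q"
    using generate_subgroup_incl[OF _ generate_is_subgroup] by blast
  with 1 show ?thesis by blast
qed

text \<open>Minimize the total depth of a finite generating set of reflections. By \<open>depth_reflect\<close>, no far side
  contains another, as replacing \<open>r\<close> by \<open>m \<otimes> r \<otimes> m\<close> keeps the generated subgroup. For
  non-commuting \<open>r\<close> and \<open>m\<close> this rules out two of the candidates for the empty quadrant, and \<open>1\<close> rules
  out a third; what remains is the intersection of the far sides.\<close>

lemma facing_generators:
  assumes "T \<subseteq> refls" "finite T"
  obtains R where "finite R" "facing R" "generate G R = generate G T"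
proof -
  define P where "P R \<longleftrightarrow> finite R \<and> R \<subseteq> refls \<and> generate G R = generate G T" for R
  have "P T" using assms by (simp add: P_def)
  then obtain R where R: "P R" and least: "\<And>Q. P Q \<Longrightarrow> sum depth R \<le> sum depth Q"
    using ex_has_least_nat[of P T "sum depth"] by metis
  then have fin: "finite R" and sub: "R \<subseteq> refls" by (auto simp: P_def)
  have not_nested: "\<exists>y\<in>carrier G. r \<in> N y \<and> m \<notin> N y" if r: "r \<in> R" and m: "m \<in> R" "m \<noteq> r" for r m
  proof (rule ccontr)
    assume "\<not> ?thesis"
    then have less: "depth (m \<otimes> r \<otimes> m) < depth r"
      using depth_reflect[of r m] r m sub by blast
    let ?Q = "insert (m \<otimes> r \<otimes> m) (R - {r})"
    have "inv m = m"
      using refl_involution[of m] inv_equality m(1) sub refls_carrier by blast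
    then have "m \<otimes> r \<otimes> m \<in> refls"
      using conj_refl[of r m] r m sub refls_carrier by (metis subsetD)
    then have "P ?Q" using R generate_reflect[OF sub r m] by (auto simp: P_def)
    then have "sum depth R \<le> sum depth ?Q" by (rule least)
    also have "\<dots> \<le> depth (m \<otimes> r \<otimes> m) + sum depth (R - {r})"
      using fin by (simp add: sum.insert_if)
    also have "\<dots> < depth r + sum depth (R - {r})" using less by simp
    also have "\<dots> = sum depth R" using fin r by (simp add: sum.remove)
    finally show False by simp
  qed
  have "r \<otimes> m = m \<otimes> r" if r: "r \<in> R" "m \<in> R" and y: "y \<in> carrier G" "r \<in> N y" "m \<in> N y" for r m y
  proof (rule ccontr)
    assume non: "r \<otimes> m \<noteq> m \<otimes> r"
    then have "r \<noteq> m" by blast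
    obtain \<epsilon> \<delta> where quad: "\<And>y. y \<in> carrier G \<Longrightarrow> (r \<in> N y) = \<epsilon> \<Longrightarrow> (m \<in> N y) \<noteq> \<delta>"
      using empty_quadrant[of r m] r sub non by blast
    obtain y1 where "y1 \<in> carrier G" "r \<in> N y1" "m \<notin> N y1"
      using not_nested[of r m] r \<open>r \<noteq> m\<close> by blast
    moreover obtain y2 where "y2 \<in> carrier G" "m \<in> N y2" "r \<notin> N y2"
      using not_nested[of m r] r \<open>r \<noteq> m\<close> by blast
    ultimately show False
      using quad[of y] quad[of \<one>] quad[of y1] quad[of y2] y by auto
  qed
  then have "facing R" using sub unfolding facing_def by blast
  then show ?thesis using that[of R] R by (simp add: P_def)
qed

text \<open>Ping-pong. Let \<open>p\<close> be the first letter of a shortest word over \<open>R\<close> for \<open>u\<close>. By induction the rest of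
  the word is not beyond \<open>p\<close>, so \<open>u\<close> is. If \<open>u\<close> is also beyond \<open>r \<noteq> p\<close>, then \<open>r\<close> and \<open>p\<close> commute, the
  rest is beyond \<open>r\<close> as well, and \<open>r\<close> moves past \<open>p\<close> to shorten the rest.\<close>

lemma facing_word_exchange:
  assumes R: "facing R" and l: "l \<in> lists R"
    and shortest: "\<And>k. k \<in> lists R \<Longrightarrow> wprod k = wprod l \<Longrightarrow> length l \<le> length k"
    and r: "r \<in> R" "r \<in> N (wprod l)"
  shows "\<exists>k\<in>lists R. length k < length l \<and> wprod k = r \<otimes> wprod l"
  using l shortest r
proof (induction l arbitrary: r)
  case Nil
  then show ?case by simp
next
  case (Cons p l)
  have refl: "r \<in> refls" "p \<in> refls" and c: "R \<subseteq> carrier G"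
    using R Cons.prems Cons.hyps refls_carrier by (auto simp: facing_def)
  have p: "p \<in> carrier G" "p \<otimes> p = \<one>" using refl refls_carrier refl_involution by auto
  have rc: "r \<in> carrier G" using refl refls_carrier by blast
  have lc: "wprod l \<in> carrier G" using Cons.hyps c by (intro wprod_closed) auto
  have shortest: "length l \<le> length k" if "k \<in> lists R" "wprod k = wprod l" for k
    using Cons.prems(1)[of "p # k"] that Cons.hyps by simp
  show ?case
  proof (cases "r = p")
    case True
    then show ?thesis using Cons.hyps p lc
      by (intro bexI[of _ l]) (simp_all add: involution_cancel)
  next
    case False
    have "p \<notin> N (wprod l)"
    proof
      assume "p \<in> N (wprod l)"
      then obtain k where "k \<in> lists R" "length k < length l" "wprod k = p \<otimes> wprod l"
        using Cons.IH[OF shortest] Cons.hyps by blast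
      then show False using Cons.prems(1)[of k] by simp
    qed
    then have "p \<in> N (wprod (p # l))"
      using N_mult[of p "wprod l" p] p lc inv_equality[of p p] reflection_crosses_own_wall[OF refl(2)]
      by simp
    then have comm: "r \<otimes> p = p \<otimes> r"
      using facingD[OF R, of r p "wprod (p # l)"] Cons.prems(2,3) Cons.hyps p lc by simp
    then have "r \<in> N (wprod l)"
      using commuting_reflection_preserves_side[OF refl comm False lc] Cons.prems(3) by simp
    then obtain k where k: "k \<in> lists R" "length k < length l" "wprod k = r \<otimes> wprod l"
      using Cons.IH[OF shortest] Cons.prems(2) by blast
    have "wprod (p # k) = r \<otimes> wprod (p # l)"
      using k(3) rc p(1) lc comm by (simp add: m_assoc[symmetric])
    then show ?thesis using k Cons.hyps by (intro bexI[of _ "p # k"]) auto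
  qed
qed

lemma facing_separates:
  assumes R: "facing R" and u: "u \<in> generate G R" "u \<noteq> \<one>"
  obtains r where "r \<in> R" "r \<in> N u"
proof -
  have sub: "R \<subseteq> refls" "R \<subseteq> carrier G" using R refls_carrier by (auto simp: facing_def)
  have gen: "generate G R = wprod ` lists R"
    using generate_involutions[OF sub(2)] refl_involution sub(1) by blast
  then obtain l0 where "l0 \<in> lists R \<and> wprod l0 = u" using u(1) by auto
  then obtain l where l: "l \<in> lists R \<and> wprod l = u"
      "\<And>k. k \<in> lists R \<and> wprod k = u \<Longrightarrow> length l \<le> length k"
    using ex_has_least_nat[of "\<lambda>l. l \<in> lists R \<and> wprod l = u" l0 length] by metis
  then obtain r k where k: "l = r # k" using u by (cases l) auto
  have r: "r \<in> R" "r \<in> refls" "r \<in> carrier G" "k \<in> lists R" using l k sub by auto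
  have kc: "wprod k \<in> carrier G" using r(4) sub(2) by (intro wprod_closed) auto
  have u_eq: "u = r \<otimes> wprod k" using l(1) k by simp
  have "r \<notin> N (wprod k)"
  proof
    assume "r \<in> N (wprod k)"
    moreover have "length k \<le> length j" if "j \<in> lists R" "wprod j = wprod k" for j
      using l(2)[of "r # j"] that r k u_eq by simp
    ultimately obtain j where "j \<in> lists R" "length j < length k" "wprod j = r \<otimes> wprod k"
      using facing_word_exchange[OF R r(4) _ r(1)] by blast
    then show False using l(2)[of j] k u_eq by simp
  qed
  then have "r \<in> N u"
    using N_mult[of r "wprod k" r] r kc u_eq inv_equality[of r r] refl_involution[of r]
      reflection_crosses_own_wall[of r] by simp
  then show ?thesis using that r by blast
qed

text \<open>Among the elements of the subgroup beyond \<open>m\<close> a shortest one is beyond some \<open>r \<in> R\<close> that does not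
  commute with \<open>m\<close>. The points \<open>1\<close>, \<open>x\<close>, \<open>u\<close> then show that the empty quadrant is the one beyond \<open>r\<close>
  and before \<open>m\<close>. As \<open>r\<close> lies beyond its own wall, it is beyond \<open>m\<close>.\<close>

lemma shared_wall_in_generator:
  assumes R: "facing R" and u: "u \<in> generate G R" "m \<in> N u"
    and x: "x \<in> carrier G" "m \<in> N x" "\<And>r. r \<in> R \<Longrightarrow> r \<notin> N x"
  shows "\<exists>r\<in>R. m \<in> N r"
  using u
proof (induction "card (N u)" arbitrary: u rule: less_induct)
  case less
  have sub: "R \<subseteq> refls" "R \<subseteq> carrier G" using R refls_carrier by (auto simp: facing_def)
  have uc: "u \<in> carrier G" using less.prems(1) generate_in_carrier sub(2) by blast
  have m: "m \<in> refls" using N_subset_refls(2)[OF x(1)] x(2) by blast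
  have "u \<noteq> \<one>" using less.prems by auto
  then obtain r where r: "r \<in> R" "r \<in> N u" using facing_separates[OF R less.prems(1)] by blast
  have rr: "r \<in> refls" "r \<in> carrier G" using r sub by auto
  have "m \<noteq> r" using x r by blast
  show ?case
  proof (cases "m \<otimes> r = r \<otimes> m")
    case True
    then have "m \<in> N (r \<otimes> u)"
      using commuting_reflection_preserves_side[OF m rr(1) True \<open>m \<noteq> r\<close> uc] less.prems by simp
    moreover have "r \<otimes> u \<in> generate G R"
      by (rule generate.eng[OF generate.incl[OF r(1)] less.prems(1)])
    moreover have "card (N (r \<otimes> u)) < card (N u)" by (rule card_N_reflect[OF r(2) uc])
    ultimately show ?thesis using less.hyps by blast
  next
    case False
    then obtain \<epsilon> \<delta> where quad: "\<And>y. y \<in> carrier G \<Longrightarrow> (m \<in> N y) = \<epsilon> \<Longrightarrow> (r \<in> N y) \<noteq> \<delta>"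
      using empty_quadrant[OF m rr(1)] by blast
    have "m \<in> N r"
      using quad[of \<one>] quad[of x] quad[of u] quad[of r] x r less.prems uc rr
        reflection_crosses_own_wall[OF rr(1)] by auto
    then show ?thesis using r by blast
  qed
qed

text \<open>The equation between lengths says that \<open>x\<close> lies on a geodesic from \<open>u\<close> to \<open>v\<close>. The bound is the number
  of walls that separate \<open>1\<close> from some member of a facing generating set, and \<open>h\<close> is an element of the
  subgroup nearest to \<open>x\<close>: if a wall of \<open>r \<in> R\<close> separated \<open>1\<close> from \<open>inv h \<otimes> x\<close>, then \<open>h \<otimes> r\<close> would
  be nearer.\<close>

lemma bounded_distance_to_reflection_subgroup:
  assumes T: "T \<subseteq> refls" "finite A" "generate G A = generate G T"
  shows "\<exists>M. \<forall>u\<in>generate G T. \<forall>v\<in>generate G T. \<forall>x\<in>carrier G.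
      card (N (inv u \<otimes> v)) = card (N (inv u \<otimes> x)) + card (N (inv x \<otimes> v)) \<longrightarrow>
      (\<exists>h\<in>generate G T. card (N (inv x \<otimes> h)) \<le> M)"
proof -
  have Tc: "T \<subseteq> carrier G" using T refls_carrier by blast
  obtain F where F: "F \<subseteq> T" "finite F" "generate G F = generate G T"
    using finite_generators_among[OF Tc T(2,3)] by blast
  obtain R where R: "finite R" "facing R" "generate G R = generate G F"
    by (rule facing_generators[OF subset_trans[OF F(1) T(1)] F(2)])
  define H where "H = generate G T"
  have H: "H = generate G R" using R F by (simp add: H_def)
  have sub: "R \<subseteq> refls" "R \<subseteq> carrier G" using R refls_carrier by (auto simp: facing_def)
  interpret H: subgroup H G unfolding H_def by (rule generate_is_subgroup[OF Tc])
  have RH: "R \<subseteq> H" unfolding H using generate.incl[of _ R G] by blast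
  define B where "B = (\<Union>r\<in>R. N r)"
  have fin: "finite B" unfolding B_def using R(1) sub N_subset_refls(1) by auto
  have "\<exists>h\<in>H. card (N (inv x \<otimes> h)) \<le> card B"
    if u: "u \<in> H" and v: "v \<in> H" and x: "x \<in> carrier G"
      and geo: "card (N (inv u \<otimes> v)) = card (N (inv u \<otimes> x)) + card (N (inv x \<otimes> v))" for u v x
  proof -
    obtain h where h: "h \<in> H" and least: "\<And>k. k \<in> H \<Longrightarrow> card (N (inv h \<otimes> x)) \<le> card (N (inv k \<otimes> x))"
      using ex_has_least_nat[of "\<lambda>h. h \<in> H" u "\<lambda>h. card (N (inv h \<otimes> x))"] u by metis
    have c: "h \<in> carrier G" "u \<in> carrier G" "v \<in> carrier G" using h u v by auto
    define x' where "x' = inv h \<otimes> x"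
    have x': "x' \<in> carrier G" using c x by (simp add: x'_def)
    have no_R: "r \<notin> N x'" if r: "r \<in> R" for r
    proof
      assume "r \<in> N x'"
      then have "card (N (r \<otimes> x')) < card (N x')" using card_N_reflect x' by blast
      moreover have "inv r = r" using refl_involution[of r] inv_equality r sub by blast
      then have "r \<otimes> x' = inv (h \<otimes> r) \<otimes> x"
        using r sub c x by (simp add: x'_def inv_mult_group m_assoc subset_iff)
      moreover have "h \<otimes> r \<in> H" using h r RH by blast
      ultimately show False using least[of "h \<otimes> r"] by (simp add: x'_def)
    qed
    have "N x' \<subseteq> B"
    proof
      fix m assume m: "m \<in> N x'"
      define u' v' where "u' = inv h \<otimes> u" and "v' = inv h \<otimes> v"
      have u'v': "u' \<in> H" "v' \<in> H" "u' \<in> carrier G" "v' \<in> carrier G"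
        using h u v by (auto simp: u'_def v'_def)
      have shift: "inv (inv h \<otimes> a) \<otimes> (inv h \<otimes> b) = inv a \<otimes> b"
        if "a \<in> carrier G" "b \<in> carrier G" for a b
        using that c by (simp add: inv_mult_group m_assoc cancel_simps)
      define D where "D a b = sym_diff (N a) (N b)" for a b
      have finD: "finite (D a b)" if "a \<in> carrier G" "b \<in> carrier G" for a b
        using that N_subset_refls(1) by (simp add: D_def)
      have "card (D u' v') = card (D u' x') + card (D x' v')"
        using geo card_N_inv_mult[of u' v'] card_N_inv_mult[of u' x'] card_N_inv_mult[of x' v']
          shift[of u v] shift[of u x] shift[of x v] c x x' u'v'
        by (simp add: D_def u'_def v'_def x'_def)
      moreover have "card (D u' v') \<le> card (D u' x' \<union> D x' v')"
        using finD x' u'v' by (intro card_mono) (auto simp: D_def)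
      moreover have "card (D u' x') + card (D x' v') = card (D u' x' \<union> D x' v') + card (D u' x' \<inter> D x' v')"
        using finD x' u'v' by (intro card_Un_Int) auto
      \<comment> \<open>Additivity of lengths means that no wall is crossed both before and after \<open>x\<close>.\<close>
      ultimately have "card (D u' x' \<inter> D x' v') = 0" by simp
      then have "D u' x' \<inter> D x' v' = {}" using finD x' u'v' by simp
      then have "m \<in> N u' \<or> m \<in> N v'" using m by (auto simp: D_def)
      then show "m \<in> B"
        using shared_wall_in_generator[OF R(2) _ _ x' m no_R] u'v' unfolding H B_def by blast
    qed
    then have "card (N x') \<le> card B" using fin by (intro card_mono)
    moreover have "card (N (inv x \<otimes> h)) = card (N x')"
    proof -
      have "card (N (inv x \<otimes> h)) = card (N (inv h \<otimes> x))"
        using card_N_inv_mult[of x h] card_N_inv_mult[of h x] c x by (simp add: Un_commute)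
      then show ?thesis by (simp add: x'_def)
    qed
    ultimately show ?thesis using h by (intro bexI[of _ h]) simp_all
  qed
  then show ?thesis unfolding H_def[symmetric] by blast
qed

section \<open>Geodesics in the Cayley graph\<close>

sublocale Cayley: wf_digraph "cayley_graph G S"
  by (rule wf_digraph_cayley_graph)

lemma cayley_graph_sel:
  "verts (cayley_graph G S) = carrier G"
  "tail (cayley_graph G S) = fst"
  "head (cayley_graph G S) = snd"
  "e \<in> arcs (cayley_graph G S) \<longleftrightarrow>
    fst e \<in> carrier G \<and> snd e \<in> carrier G \<and> (\<exists>s\<in>S. snd e = fst e \<otimes> s \<or> fst e = snd e \<otimes> s)"
  by (auto simp: cayley_graph_def)

text \<open>Each edge crosses exactly one wall.\<close>

lemma awalk_length_ge:
  assumes "Cayley.awalk u p v" "v \<in> carrier G"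
  shows "card (N (inv u \<otimes> v)) \<le> length p"
  using assms
proof (induction p arbitrary: u)
  case Nil
  then show ?case by (simp add: Cayley.awalk_Nil_iff)
next
  case (Cons e p)
  define u' where "u' = snd e"
  have e: "u = fst e" "e \<in> arcs (cayley_graph G S)" "Cayley.awalk u' p v"
    using Cons.prems(1) by (auto simp: Cayley.awalk_Cons_iff cayley_graph_sel u'_def)
  then obtain s where s: "s \<in> S" "u' = u \<otimes> s \<or> u = u' \<otimes> s"
    and c: "u \<in> carrier G" "u' \<in> carrier G"
    by (auto simp: cayley_graph_sel u'_def)
  from s(2) have "inv u \<otimes> v = s \<otimes> (inv u' \<otimes> v)"
  proof
    assume u': "u' = u \<otimes> s"
    show ?thesis unfolding u' using s(1) c(1) Cons.prems(2)
      by (simp add: inv_mult_group m_assoc involution_cancel S_involution)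
  next
    assume u: "u = u' \<otimes> s"
    show ?thesis unfolding u using s(1) c(2) Cons.prems(2)
      by (simp add: inv_mult_group m_assoc)
  qed
  then have "card (N (inv u \<otimes> v)) \<le> Suc (card (N (inv u' \<otimes> v)))"
    using card_N_generator_mult[OF s(1)] c Cons.prems(2) by simp
  then show ?case using Cons.IH[OF e(3) Cons.prems(2)] by simp
qed

lemma awalk_of_word:
  assumes "l \<in> lists S" "u \<in> carrier G"
  shows "\<exists>p. Cayley.awalk u p (u \<otimes> wprod l) \<and> length p = length l"
  using assms
proof (induction arbitrary: u)
  case Nil
  then show ?case by (auto simp: Cayley.awalk_Nil_iff cayley_graph_sel)
next
  case (Cons s l)
  then have us: "u \<otimes> s \<in> carrier G" by simp
  obtain p where "Cayley.awalk (u \<otimes> s) p (u \<otimes> s \<otimes> wprod l)" "length p = length l"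
    using Cons.IH[OF us] by blast
  then have "Cayley.awalk u ((u, u \<otimes> s) # p) (u \<otimes> wprod (s # l))"
    using Cons.hyps Cons.prems us
    by (auto simp: Cayley.awalk_Cons_iff cayley_graph_sel m_assoc)
  then show ?case using \<open>length p = length l\<close> by (intro exI[of _ "(u, u \<otimes> s) # p"]) simp
qed

lemma graph_dist_eq:
  assumes "u \<in> carrier G" "v \<in> carrier G"
  shows "graph_dist (cayley_graph G S) u v = ereal (real (card (N (inv u \<otimes> v))))"
proof -
  have cost: "Cayley.awalk_cost (\<lambda>_. 1) p = real (length p)" for p
    by (induction p) (simp_all add: Cayley.awalk_cost_def)
  obtain l where l: "l \<in> lists S" "wprod l = inv u \<otimes> v" "length l = card (N (inv u \<otimes> v))"
    by (rule reduced_word[OF m_closed[OF inv_closed[OF assms(1)] assms(2)]])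
  obtain p where p: "Cayley.awalk u p (u \<otimes> wprod l)" "length p = length l"
    using awalk_of_word[OF l(1) assms(1)] by blast
  have "u \<otimes> wprod l = v" using l assms by (simp add: cancel_simps)
  then have p': "Cayley.awalk u p v" using p by simp
  show ?thesis unfolding graph_dist_def Cayley.\<mu>_def cost
  proof (rule antisym)
    show "(INF p\<in>{p. Cayley.awalk u p v}. ereal (real (length p))) \<le> ereal (real (card (N (inv u \<otimes> v))))"
      using p' p(2) l(3) by (intro INF_lower2[of p]) auto
    show "ereal (real (card (N (inv u \<otimes> v)))) \<le> (INF p\<in>{p. Cayley.awalk u p v}. ereal (real (length p)))"
      using awalk_length_ge assms by (intro INF_greatest) auto
  qed
qed

lemma geodesic_length_split:
  assumes geo: "geodesic (cayley_graph G S) u p v"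
    and uv: "u \<in> carrier G" "v \<in> carrier G" and x: "x \<in> set (Cayley.awalk_verts u p)"
  shows "x \<in> carrier G"
    and "card (N (inv u \<otimes> v)) = card (N (inv u \<otimes> x)) + card (N (inv x \<otimes> v))"
proof -
  have p: "Cayley.awalk u p v" "length p = card (N (inv u \<otimes> v))"
    using geo graph_dist_eq[OF uv] by (auto simp: geodesic_def)
  obtain q r where qr: "p = q @ r" "Cayley.awalk u q x" "Cayley.awalk x r v"
    using Cayley.awalk_decomp[OF p(1) x] by blast
  show xc: "x \<in> carrier G"
    using Cayley.awalk_last_in_verts[OF qr(2)] by (simp add: cayley_graph_sel)
  have "sym_diff (N u) (N v) \<subseteq> sym_diff (N u) (N x) \<union> sym_diff (N x) (N v)"
    by blast
  then have "card (N (inv u \<otimes> v)) \<le> card (sym_diff (N u) (N x) \<union> sym_diff (N x) (N v))"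
    unfolding card_N_inv_mult[OF uv]
    using uv xc N_subset_refls(1) by (intro card_mono) auto
  also have "\<dots> \<le> card (N (inv u \<otimes> x)) + card (N (inv x \<otimes> v))"
    unfolding card_N_inv_mult[OF uv(1) xc] card_N_inv_mult[OF xc uv(2)] by (rule card_Un_le)
  finally show "card (N (inv u \<otimes> v)) = card (N (inv u \<otimes> x)) + card (N (inv x \<otimes> v))"
    using awalk_length_ge[OF qr(2) xc] awalk_length_ge[OF qr(3) uv(2)] p(2) qr(1) by simp
qed

theorem reflection_subgroup_quasiconvex:
  assumes T: "T \<subseteq> refls" "finite A" "generate G A = generate G T"
  shows "quasiconvex G S (generate G T)"
proof -
  have H: "generate G T \<subseteq> carrier G"
    by (rule generate_incl[OF subset_trans[OF T(1) refls_carrier]])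
  obtain M where M: "\<forall>u\<in>generate G T. \<forall>v\<in>generate G T. \<forall>x\<in>carrier G.
      card (N (inv u \<otimes> v)) = card (N (inv u \<otimes> x)) + card (N (inv x \<otimes> v)) \<longrightarrow>
      (\<exists>h\<in>generate G T. card (N (inv x \<otimes> h)) \<le> M)"
    using bounded_distance_to_reflection_subgroup[OF T] ..
  show ?thesis unfolding quasiconvex_def
  proof (intro exI[of _ "real M"] conjI ballI allI impI)
    fix u v p x
    assume u: "u \<in> generate G T" and v: "v \<in> generate G T"
      and geo: "geodesic (cayley_graph G S) u p v"
      and x: "x \<in> set (Cayley.awalk_verts u p)"
    have uv: "u \<in> carrier G" "v \<in> carrier G" using u v H by auto
    note split = geodesic_length_split[OF geo uv x]
    obtain h where h: "h \<in> generate G T" "card (N (inv x \<otimes> h)) \<le> M"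
      using M u v split by blast
    moreover have "graph_dist (cayley_graph G S) x h = ereal (real (card (N (inv x \<otimes> h))))"
      using graph_dist_eq[OF split(1)] h(1) H by blast
    ultimately show "\<exists>h\<in>generate G T. graph_dist (cayley_graph G S) x h \<le> ereal (real M)"
      by (intro bexI[of _ h]) simp_all
  qed simp
qed

end

section \<open>The walls of a right-angled Coxeter group\<close>

text \<open>A letter and its formal inverse act in the same way, as suits generators that act as involutions.\<close>

definition word_act :: "('a \<Rightarrow> 'x \<Rightarrow> 'x) \<Rightarrow> 'a word \<Rightarrow> 'x \<Rightarrow> 'x" where
  "word_act f w = foldr (\<lambda>l. f (fst l)) w"

lemma word_act_simps [simp]:
  "word_act f [] x = x"
  "word_act f (l # w) x = f (fst l) (word_act f w x)"
  "word_act f (v @ w) x = word_act f v (word_act f w x)"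
  by (simp_all add: word_act_def)

lemma word_act_closed:
  assumes "\<And>s x. s \<in> V \<Longrightarrow> x \<in> U \<Longrightarrow> f s x \<in> U" "w \<in> words V" "x \<in> U"
  shows "word_act f w x \<in> U"
  using assms(2)
proof (induction w)
  case Nil
  then show ?case using assms(3) by simp
next
  case (Cons l w)
  then show ?case using assms(1) by (cases l) auto
qed

lemma word_act_pres_eq:
  assumes "(v, w) \<in> pres_eq (verts \<Gamma>) (racg_relations \<Gamma>)"
    and closed: "\<And>s x. s \<in> verts \<Gamma> \<Longrightarrow> x \<in> U \<Longrightarrow> f s x \<in> U"
    and invol: "\<And>s x. s \<in> verts \<Gamma> \<Longrightarrow> x \<in> U \<Longrightarrow> f s (f s x) = x"
    and comm: "\<And>s t x. s \<in> verts \<Gamma> \<Longrightarrow> t \<in> verts \<Gamma> \<Longrightarrow> s \<rightarrow>\<^bsub>\<Gamma>\<^esub> t \<Longrightarrow> x \<in> U \<Longrightarrow> f s (f t x) = f t (f s x)"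
    and "x \<in> U"
  shows "word_act f v x = word_act f w x"
  using assms(1,5)
proof (induction arbitrary: x rule: pres_eq.induct)
  case (cancel u v s b)
  have "word_act f v x \<in> U" using word_act_closed[OF closed cancel(2,4)] .
  then show ?case using invol[OF cancel(3)] by simp
next
  case (relation u v l r)
  have U: "word_act f v x \<in> U" using word_act_closed[OF closed relation(2,6)] .
  from relation(3) have "word_act f l (word_act f v x) = word_act f r (word_act f v x)"
    unfolding racg_relations_def
  proof
    assume "(l, r) \<in> {([(s, False), (s, False)], []) | s. s \<in> verts \<Gamma>}"
    then show ?thesis using invol U by auto
  next
    assume "(l, r) \<in> {([(s, False), (t, False)], [(t, False), (s, False)]) | s t. s \<rightarrow>\<^bsub>\<Gamma>\<^esub> t}"
    then obtain s t where "l = [(s, False), (t, False)]" "r = [(t, False), (s, False)]" "s \<rightarrow>\<^bsub>\<Gamma>\<^esub> t"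
      by blast
    then show ?thesis using comm[of s t] relation(4) U by simp
  qed
  then show ?case by simp
qed simp_all

lemma racg_carrierE:
  assumes "g \<in> carrier (racg \<Gamma>)"
  obtains w where "w \<in> words (verts \<Gamma>)" "g = pres_eq (verts \<Gamma>) (racg_relations \<Gamma>) `` {w}"
  using assms by (auto simp: racg_def presented_group_def elim: quotientE)

lemma racg_class_carrier:
  "w \<in> words (verts \<Gamma>) \<Longrightarrow> pres_eq (verts \<Gamma>) (racg_relations \<Gamma>) `` {w} \<in> carrier (racg \<Gamma>)"
  by (simp add: racg_def presented_group_def quotientI)

lemma racg_class_mult:
  "v \<in> words (verts \<Gamma>) \<Longrightarrow> w \<in> words (verts \<Gamma>) \<Longrightarrow>
    pres_eq (verts \<Gamma>) (racg_relations \<Gamma>) `` {v} \<otimes>\<^bsub>racg \<Gamma>\<^esub> pres_eq (verts \<Gamma>) (racg_relations \<Gamma>) `` {w}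
      = pres_eq (verts \<Gamma>) (racg_relations \<Gamma>) `` {v @ w}"
  unfolding racg_def by (rule presented_group_mult)

lemma racg_one: "\<one>\<^bsub>racg \<Gamma>\<^esub> = pres_eq (verts \<Gamma>) (racg_relations \<Gamma>) `` {[]}"
  by (simp add: racg_def presented_group_def)

lemma racg_class_eq:
  "(v, w) \<in> pres_eq (verts \<Gamma>) (racg_relations \<Gamma>) \<Longrightarrow>
    pres_eq (verts \<Gamma>) (racg_relations \<Gamma>) `` {v} = pres_eq (verts \<Gamma>) (racg_relations \<Gamma>) `` {w}"
  by (rule equiv_class_eq[OF equiv_pres_eq])

lemma racg_gen_carrier: "s \<in> verts \<Gamma> \<Longrightarrow> racg_gen \<Gamma> s \<in> carrier (racg \<Gamma>)"
  unfolding racg_gen_def pres_gen_def by (rule racg_class_carrier) simp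

lemma racg_gen_involution:
  assumes "s \<in> verts \<Gamma>"
  shows "racg_gen \<Gamma> s \<otimes>\<^bsub>racg \<Gamma>\<^esub> racg_gen \<Gamma> s = \<one>\<^bsub>racg \<Gamma>\<^esub>"
proof -
  have "([(s, False), (s, False)], []) \<in> pres_eq (verts \<Gamma>) (racg_relations \<Gamma>)"
    using pres_eq.relation[of "[]" "verts \<Gamma>" "[]" "[(s, False), (s, False)]" "[]" "racg_relations \<Gamma>"] assms
    by (simp add: racg_relations_def)
  from racg_class_eq[OF this] show ?thesis
    using assms by (simp add: racg_gen_def pres_gen_def racg_class_mult racg_one)
qed

lemma racg_gen_commute:
  assumes "s \<in> verts \<Gamma>" "t \<in> verts \<Gamma>" "s \<rightarrow>\<^bsub>\<Gamma>\<^esub> t"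
  shows "racg_gen \<Gamma> s \<otimes>\<^bsub>racg \<Gamma>\<^esub> racg_gen \<Gamma> t = racg_gen \<Gamma> t \<otimes>\<^bsub>racg \<Gamma>\<^esub> racg_gen \<Gamma> s"
proof -
  have "([(s, False), (t, False)], [(t, False), (s, False)]) \<in> racg_relations \<Gamma>"
    using assms(3) by (auto simp: racg_relations_def)
  then have "([(s, False), (t, False)], [(t, False), (s, False)]) \<in> pres_eq (verts \<Gamma>) (racg_relations \<Gamma>)"
    using pres_eq.relation[of "[]" "verts \<Gamma>" "[]" "[(s, False), (t, False)]" "[(t, False), (s, False)]"]
      assms(1,2) by simp
  from racg_class_eq[OF this] show ?thesis
    using assms by (simp add: racg_gen_def pres_gen_def racg_class_mult)
qed

lemma racg_generated: "generate (racg \<Gamma>) (racg_gen \<Gamma> ` verts \<Gamma>) = carrier (racg \<Gamma>)"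
proof
  interpret group "racg \<Gamma>" by (rule group_racg)
  show "generate (racg \<Gamma>) (racg_gen \<Gamma> ` verts \<Gamma>) \<subseteq> carrier (racg \<Gamma>)"
    using racg_gen_carrier by (intro generate_incl) auto
  have "pres_eq (verts \<Gamma>) (racg_relations \<Gamma>) `` {w} \<in> generate (racg \<Gamma>) (racg_gen \<Gamma> ` verts \<Gamma>)"
    if "w \<in> words (verts \<Gamma>)" for w
    using that
  proof (induction w)
    case Nil
    then show ?case by (simp add: generate.one flip: racg_one)
  next
    case (Cons l w)
    obtain s b where l: "l = (s, b)" by (cases l)
    have s: "s \<in> verts \<Gamma>" "w \<in> words (verts \<Gamma>)" using Cons.prems l by auto
    have "([(s, True)], [(s, False)]) \<in> pres_eq (verts \<Gamma>) (racg_relations \<Gamma>)"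
    proof (rule pres_eq.trans)
      have "([(s, False), (s, False)], []) \<in> racg_relations \<Gamma>"
        using s(1) by (auto simp: racg_relations_def)
      then show "([(s, True)], [(s, False), (s, False), (s, True)]) \<in> pres_eq (verts \<Gamma>) (racg_relations \<Gamma>)"
        using pres_eq.sym[OF pres_eq.relation[of "[]" "verts \<Gamma>" "[(s, True)]" "[(s, False), (s, False)]" "[]"]]
          s(1) by simp
      show "([(s, False), (s, False), (s, True)], [(s, False)]) \<in> pres_eq (verts \<Gamma>) (racg_relations \<Gamma>)"
        using pres_eq.cancel[of "[(s, False)]" "verts \<Gamma>" "[]" s False] s(1) by simp
    qed
    then have "pres_eq (verts \<Gamma>) (racg_relations \<Gamma>) `` {[(s, b)]} = racg_gen \<Gamma> s"
      unfolding racg_gen_def pres_gen_def using racg_class_eq by (cases b) auto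
    then have "pres_eq (verts \<Gamma>) (racg_relations \<Gamma>) `` {l # w} =
        racg_gen \<Gamma> s \<otimes>\<^bsub>racg \<Gamma>\<^esub> pres_eq (verts \<Gamma>) (racg_relations \<Gamma>) `` {w}"
      using racg_class_mult[of "[(s, b)]" \<Gamma> w] s l by simp
    then show ?case using Cons.IH[OF s(2)] s(1) by (simp add: generate.eng generate.incl)
  qed
  then show "carrier (racg \<Gamma>) \<subseteq> generate (racg \<Gamma>) (racg_gen \<Gamma> ` verts \<Gamma>)"
    using racg_carrierE by blast
qed

text \<open>The universal property of the presentation, for actions: involutions of \<open>U\<close> that commute for adjacent
  vertices extend to an action of the whole group.\<close>

lemma racg_action:
  assumes closed: "\<And>s x. s \<in> verts \<Gamma> \<Longrightarrow> x \<in> U \<Longrightarrow> f s x \<in> U"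
    and invol: "\<And>s x. s \<in> verts \<Gamma> \<Longrightarrow> x \<in> U \<Longrightarrow> f s (f s x) = x"
    and comm: "\<And>s t x. s \<in> verts \<Gamma> \<Longrightarrow> t \<in> verts \<Gamma> \<Longrightarrow> s \<rightarrow>\<^bsub>\<Gamma>\<^esub> t \<Longrightarrow> x \<in> U \<Longrightarrow> f s (f t x) = f t (f s x)"
  shows "\<exists>F.
    (\<forall>g\<in>carrier (racg \<Gamma>). \<forall>x\<in>U. F g x \<in> U) \<and>
    (\<forall>g\<in>carrier (racg \<Gamma>). \<forall>h\<in>carrier (racg \<Gamma>). \<forall>x\<in>U. F (g \<otimes>\<^bsub>racg \<Gamma>\<^esub> h) x = F g (F h x)) \<and>
    (\<forall>x\<in>U. F \<one>\<^bsub>racg \<Gamma>\<^esub> x = x) \<and>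
    (\<forall>s\<in>verts \<Gamma>. \<forall>x\<in>U. F (racg_gen \<Gamma> s) x = f s x)"
proof -
  define F where "F C = word_act f (SOME w. w \<in> C)" for C
  let ?c = "\<lambda>w. pres_eq (verts \<Gamma>) (racg_relations \<Gamma>) `` {w}"
  have F: "F (?c w) x = word_act f w x" if w: "w \<in> words (verts \<Gamma>)" and x: "x \<in> U" for w x
  proof -
    have "w \<in> ?c w" using w by (simp add: pres_eq.refl)
    then have "(SOME v. v \<in> ?c w) \<in> ?c w" by (rule someI)
    then have "(w, SOME v. v \<in> ?c w) \<in> pres_eq (verts \<Gamma>) (racg_relations \<Gamma>)" by simp
    from word_act_pres_eq[where f = f and U = U, OF this closed invol comm x] show ?thesis by (simp add: F_def)
  qed
  have act_closed: "word_act f w x \<in> U" if "w \<in> words (verts \<Gamma>)" "x \<in> U" for w x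
    by (rule word_act_closed[OF closed that])
  show ?thesis
  proof (intro exI[of _ F] conjI ballI)
    fix g x assume g: "g \<in> carrier (racg \<Gamma>)" and x: "x \<in> U"
    from racg_carrierE[OF g] obtain w where w: "w \<in> words (verts \<Gamma>)" "g = ?c w" .
    show "F g x \<in> U" using act_closed[OF w(1) x] F[OF w(1) x] w(2) by simp
  next
    fix g h x assume g: "g \<in> carrier (racg \<Gamma>)" and h: "h \<in> carrier (racg \<Gamma>)" and x: "x \<in> U"
    from racg_carrierE[OF g] obtain v where v: "v \<in> words (verts \<Gamma>)" "g = ?c v" .
    from racg_carrierE[OF h] obtain w where w: "w \<in> words (verts \<Gamma>)" "h = ?c w" .
    have "g \<otimes>\<^bsub>racg \<Gamma>\<^esub> h = ?c (v @ w)" using racg_class_mult v w by simp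
    then show "F (g \<otimes>\<^bsub>racg \<Gamma>\<^esub> h) x = F g (F h x)"
      using F[of "v @ w" x] F[OF w(1) x] F[OF v(1) act_closed[OF w(1) x]] v w x by simp
  next
    fix x assume "x \<in> U"
    then show "F \<one>\<^bsub>racg \<Gamma>\<^esub> x = x" using F[of "[]" x] by (simp add: racg_one)
  next
    fix s x assume "s \<in> verts \<Gamma>" "x \<in> U"
    then show "F (racg_gen \<Gamma> s) x = f s x"
      using F[of "[(s, False)]" x] by (simp add: racg_gen_def pres_gen_def)
  qed
qed

text \<open>Non-commuting generators belong to distinct non-adjacent vertices \<open>s\<close>, \<open>t\<close>. Letting all other
  vertices act trivially on the integers respects every relation, since none involves
  both \<open>s\<close> and \<open>t\<close>.\<close>

lemma racg_infinite_dihedral: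
  assumes a: "a \<in> racg_gen \<Gamma> ` verts \<Gamma>" and b: "b \<in> racg_gen \<Gamma> ` verts \<Gamma>"
    and non: "a \<otimes>\<^bsub>racg \<Gamma>\<^esub> b \<noteq> b \<otimes>\<^bsub>racg \<Gamma>\<^esub> a"
  shows "\<exists>F :: 'a word set \<Rightarrow> int \<Rightarrow> int.
      (\<forall>g\<in>carrier (racg \<Gamma>). \<forall>h\<in>carrier (racg \<Gamma>). F (g \<otimes>\<^bsub>racg \<Gamma>\<^esub> h) = F g \<circ> F h) \<and>
      F a = uminus \<and> F b = (\<lambda>x. 1 - x)"
proof -
  obtain s t where s: "s \<in> verts \<Gamma>" "a = racg_gen \<Gamma> s" and t: "t \<in> verts \<Gamma>" "b = racg_gen \<Gamma> t"
    using a b by blast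
  have st: "s \<noteq> t" "\<not> s \<rightarrow>\<^bsub>\<Gamma>\<^esub> t" "\<not> t \<rightarrow>\<^bsub>\<Gamma>\<^esub> s"
    using non racg_gen_commute[of s \<Gamma> t] racg_gen_commute[of t \<Gamma> s] s t by auto
  define f :: "'a \<Rightarrow> int \<Rightarrow> int"
    where "f v = (if v = s then uminus else if v = t then (\<lambda>x. 1 - x) else id)" for v
  have f_commute: "f v (f w x) = f w (f v x)" if "v \<rightarrow>\<^bsub>\<Gamma>\<^esub> w" for v w x
    using that st by (auto simp: f_def)
  have f_involution: "f v (f v x) = x" for v x by (simp add: f_def)
  have "\<exists>F. (\<forall>g\<in>carrier (racg \<Gamma>). \<forall>x\<in>UNIV. F g x \<in> UNIV) \<and>
      (\<forall>g\<in>carrier (racg \<Gamma>). \<forall>h\<in>carrier (racg \<Gamma>). \<forall>x\<in>UNIV. F (g \<otimes>\<^bsub>racg \<Gamma>\<^esub> h) x = F g (F h x)) \<and>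
      (\<forall>x\<in>UNIV. F \<one>\<^bsub>racg \<Gamma>\<^esub> x = x) \<and>
      (\<forall>v\<in>verts \<Gamma>. \<forall>x\<in>UNIV. F (racg_gen \<Gamma> v) x = f v x)"
    by (rule racg_action[OF UNIV_I f_involution f_commute])
  then obtain F where
    F: "\<forall>g\<in>carrier (racg \<Gamma>). \<forall>h\<in>carrier (racg \<Gamma>). \<forall>x. F (g \<otimes>\<^bsub>racg \<Gamma>\<^esub> h) x = F g (F h x)"
      "\<forall>v\<in>verts \<Gamma>. \<forall>x. F (racg_gen \<Gamma> v) x = f v x"
    by auto
  have "F a = uminus" "F b = (\<lambda>x. 1 - x)"
    using F(2) s t st(1) by (auto simp: f_def fun_eq_iff)
  then show ?thesis using F(1) by (intro exI[of _ F]) (simp add: fun_eq_iff)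
qed

text \<open>Let a generator \<open>\<sigma>\<close> send a set \<open>X\<close> of group elements to the symmetric difference of \<open>{\<sigma>}\<close> and the
  \<open>\<sigma>\<close>-conjugate of \<open>X\<close>. These maps satisfy the relations, so they extend to an action of the group, and
  the orbit map of the empty set is the required cocycle.\<close>

lemma racg_wall_group:
  obtains N where "wall_group (racg \<Gamma>) (racg_gen \<Gamma> ` verts \<Gamma>) N"
proof -
  interpret group "racg \<Gamma>" by (rule group_racg)
  let ?S = "racg_gen \<Gamma> ` verts \<Gamma>"
  let ?\<sigma> = "racg_gen \<Gamma>"
  let ?C = "carrier (racg \<Gamma>)"
  note simps = m_assoc involution_cancel racg_gen_involution racg_gen_carrier
  have S: "?S \<subseteq> ?C" by (auto intro: racg_gen_carrier)
  have S_involution: "a \<otimes>\<^bsub>racg \<Gamma>\<^esub> a = \<one>\<^bsub>racg \<Gamma>\<^esub>" if "a \<in> ?S" for a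
    using that by (elim imageE) (simp add: racg_gen_involution)
  define f where "f s X = {r \<in> ?C. (r = ?\<sigma> s) \<noteq> (?\<sigma> s \<otimes>\<^bsub>racg \<Gamma>\<^esub> r \<otimes>\<^bsub>racg \<Gamma>\<^esub> ?\<sigma> s \<in> X)}" for s X
  have conj_twice: "?\<sigma> s \<otimes>\<^bsub>racg \<Gamma>\<^esub> (?\<sigma> s \<otimes>\<^bsub>racg \<Gamma>\<^esub> r \<otimes>\<^bsub>racg \<Gamma>\<^esub> ?\<sigma> s) \<otimes>\<^bsub>racg \<Gamma>\<^esub> ?\<sigma> s = r"
    if "s \<in> verts \<Gamma>" "r \<in> ?C" for s r
    using that by (simp add: simps)
  have conj_eq: "?\<sigma> s \<otimes>\<^bsub>racg \<Gamma>\<^esub> r \<otimes>\<^bsub>racg \<Gamma>\<^esub> ?\<sigma> s = q \<longleftrightarrow> r = ?\<sigma> s \<otimes>\<^bsub>racg \<Gamma>\<^esub> q \<otimes>\<^bsub>racg \<Gamma>\<^esub> ?\<sigma> s"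
    if "s \<in> verts \<Gamma>" "r \<in> ?C" "q \<in> ?C" for s r q
  proof
    assume e: "?\<sigma> s \<otimes>\<^bsub>racg \<Gamma>\<^esub> r \<otimes>\<^bsub>racg \<Gamma>\<^esub> ?\<sigma> s = q"
    show "r = ?\<sigma> s \<otimes>\<^bsub>racg \<Gamma>\<^esub> q \<otimes>\<^bsub>racg \<Gamma>\<^esub> ?\<sigma> s"
      using conj_twice[OF that(1,2), symmetric] unfolding e .
  next
    assume e: "r = ?\<sigma> s \<otimes>\<^bsub>racg \<Gamma>\<^esub> q \<otimes>\<^bsub>racg \<Gamma>\<^esub> ?\<sigma> s"
    show "?\<sigma> s \<otimes>\<^bsub>racg \<Gamma>\<^esub> r \<otimes>\<^bsub>racg \<Gamma>\<^esub> ?\<sigma> s = q"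
      unfolding e by (rule conj_twice[OF that(1,3)])
  qed
  have f_closed: "f s X \<in> Pow ?C" for s X by (auto simp: f_def)
  have f_involution: "f s (f s X) = X" if s: "s \<in> verts \<Gamma>" and X: "X \<in> Pow ?C" for s X
  proof (rule Set.set_eqI)
    fix r
    show "r \<in> f s (f s X) \<longleftrightarrow> r \<in> X"
    proof (cases "r \<in> ?C")
      case True
      have fix_s: "?\<sigma> s \<otimes>\<^bsub>racg \<Gamma>\<^esub> ?\<sigma> s \<otimes>\<^bsub>racg \<Gamma>\<^esub> ?\<sigma> s = ?\<sigma> s"
        using s by (simp add: racg_gen_involution racg_gen_carrier)
      have "?\<sigma> s \<otimes>\<^bsub>racg \<Gamma>\<^esub> r \<otimes>\<^bsub>racg \<Gamma>\<^esub> ?\<sigma> s \<in> ?C" using True s by (simp add: racg_gen_carrier)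
      then show ?thesis
        using True conj_eq[OF s True racg_gen_carrier[OF s]]
        unfolding f_def mem_Collect_eq conj_twice[OF s True] fix_s by blast
    qed (use X in \<open>auto simp: f_def\<close>)
  qed
  have f_commute: "f s (f t X) = f t (f s X)"
    if st: "s \<in> verts \<Gamma>" "t \<in> verts \<Gamma>" "s \<rightarrow>\<^bsub>\<Gamma>\<^esub> t" for s t X
  proof -
    note comm = racg_gen_commute[OF st]
    have fix_t: "?\<sigma> s \<otimes>\<^bsub>racg \<Gamma>\<^esub> ?\<sigma> t \<otimes>\<^bsub>racg \<Gamma>\<^esub> ?\<sigma> s = ?\<sigma> t"
      unfolding comm using st by (simp add: simps)
    have fix_s: "?\<sigma> t \<otimes>\<^bsub>racg \<Gamma>\<^esub> ?\<sigma> s \<otimes>\<^bsub>racg \<Gamma>\<^esub> ?\<sigma> t = ?\<sigma> s"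
      unfolding comm[symmetric] using st by (simp add: simps)
    have "r \<in> f s (f t X) \<longleftrightarrow> r \<in> f t (f s X)" if r: "r \<in> ?C" for r
    proof -
      have s: "?\<sigma> t \<otimes>\<^bsub>racg \<Gamma>\<^esub> r \<otimes>\<^bsub>racg \<Gamma>\<^esub> ?\<sigma> t = ?\<sigma> s \<longleftrightarrow> r = ?\<sigma> s"
        using conj_eq[OF st(2) r racg_gen_carrier[OF st(1)]] unfolding fix_s .
      have t: "?\<sigma> s \<otimes>\<^bsub>racg \<Gamma>\<^esub> r \<otimes>\<^bsub>racg \<Gamma>\<^esub> ?\<sigma> s = ?\<sigma> t \<longleftrightarrow> r = ?\<sigma> t"
        using conj_eq[OF st(1) r racg_gen_carrier[OF st(2)]] unfolding fix_t .
      have "?\<sigma> t \<otimes>\<^bsub>racg \<Gamma>\<^esub> (?\<sigma> s \<otimes>\<^bsub>racg \<Gamma>\<^esub> r \<otimes>\<^bsub>racg \<Gamma>\<^esub> ?\<sigma> s) \<otimes>\<^bsub>racg \<Gamma>\<^esub> ?\<sigma> t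
          = (?\<sigma> t \<otimes>\<^bsub>racg \<Gamma>\<^esub> ?\<sigma> s) \<otimes>\<^bsub>racg \<Gamma>\<^esub> r \<otimes>\<^bsub>racg \<Gamma>\<^esub> (?\<sigma> s \<otimes>\<^bsub>racg \<Gamma>\<^esub> ?\<sigma> t)"
        using r st by (simp add: m_assoc racg_gen_carrier)
      also have "\<dots> = (?\<sigma> s \<otimes>\<^bsub>racg \<Gamma>\<^esub> ?\<sigma> t) \<otimes>\<^bsub>racg \<Gamma>\<^esub> r \<otimes>\<^bsub>racg \<Gamma>\<^esub> (?\<sigma> t \<otimes>\<^bsub>racg \<Gamma>\<^esub> ?\<sigma> s)"
        unfolding comm ..
      also have "\<dots> = ?\<sigma> s \<otimes>\<^bsub>racg \<Gamma>\<^esub> (?\<sigma> t \<otimes>\<^bsub>racg \<Gamma>\<^esub> r \<otimes>\<^bsub>racg \<Gamma>\<^esub> ?\<sigma> t) \<otimes>\<^bsub>racg \<Gamma>\<^esub> ?\<sigma> s"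
        using r st by (simp add: m_assoc racg_gen_carrier)
      finally have st_conj: "?\<sigma> t \<otimes>\<^bsub>racg \<Gamma>\<^esub> (?\<sigma> s \<otimes>\<^bsub>racg \<Gamma>\<^esub> r \<otimes>\<^bsub>racg \<Gamma>\<^esub> ?\<sigma> s) \<otimes>\<^bsub>racg \<Gamma>\<^esub> ?\<sigma> t
          = ?\<sigma> s \<otimes>\<^bsub>racg \<Gamma>\<^esub> (?\<sigma> t \<otimes>\<^bsub>racg \<Gamma>\<^esub> r \<otimes>\<^bsub>racg \<Gamma>\<^esub> ?\<sigma> t) \<otimes>\<^bsub>racg \<Gamma>\<^esub> ?\<sigma> s" .
      have "?\<sigma> s \<otimes>\<^bsub>racg \<Gamma>\<^esub> r \<otimes>\<^bsub>racg \<Gamma>\<^esub> ?\<sigma> s \<in> ?C" "?\<sigma> t \<otimes>\<^bsub>racg \<Gamma>\<^esub> r \<otimes>\<^bsub>racg \<Gamma>\<^esub> ?\<sigma> t \<in> ?C"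
        using r st by (simp_all add: racg_gen_carrier)
      then show ?thesis using r unfolding f_def mem_Collect_eq s t st_conj by blast
    qed
    moreover have "f s (f t X) \<subseteq> ?C" "f t (f s X) \<subseteq> ?C" by (auto simp: f_def)
    ultimately show ?thesis by blast
  qed
  obtain F where
    F: "(\<forall>g\<in>?C. \<forall>X\<in>Pow ?C. F g X \<in> Pow ?C) \<and>
      (\<forall>g\<in>?C. \<forall>h\<in>?C. \<forall>X\<in>Pow ?C. F (g \<otimes>\<^bsub>racg \<Gamma>\<^esub> h) X = F g (F h X)) \<and>
      (\<forall>X\<in>Pow ?C. F \<one>\<^bsub>racg \<Gamma>\<^esub> X = X) \<and>
      (\<forall>s\<in>verts \<Gamma>. \<forall>X\<in>Pow ?C. F (?\<sigma> s) X = f s X)"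
    using racg_action[of \<Gamma> "Pow ?C" f, OF f_closed f_involution f_commute] ..
  note F_closed = F[THEN conjunct1, rule_format]
  note F_mult = F[THEN conjunct2, THEN conjunct1, rule_format]
  note F_one = F[THEN conjunct2, THEN conjunct2, THEN conjunct1, rule_format]
  note F_gen = F[THEN conjunct2, THEN conjunct2, THEN conjunct2, rule_format]
  define N where "N g = F g {}" for g
  have N_closed: "N g \<in> Pow ?C" if "g \<in> ?C" for g using F_closed that by (simp add: N_def)
  have cocycle: "r \<in> F g X \<longleftrightarrow> (r \<in> N g) \<noteq> (inv\<^bsub>racg \<Gamma>\<^esub> g \<otimes>\<^bsub>racg \<Gamma>\<^esub> r \<otimes>\<^bsub>racg \<Gamma>\<^esub> g \<in> X)"
    if "g \<in> ?C" "r \<in> ?C" and X: "X \<in> Pow ?C" for g r X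
  proof -
    have "generate (racg \<Gamma>) ?S = wprod ` lists ?S"
      by (rule generate_involutions[OF S S_involution])
    then have "g \<in> wprod ` lists ?S" using \<open>g \<in> ?C\<close> unfolding racg_generated by simp
    then obtain l where l: "l \<in> lists ?S" "g = wprod l" by (elim imageE)
    from l(1) \<open>r \<in> ?C\<close> have "r \<in> F (wprod l) X \<longleftrightarrow>
        (r \<in> N (wprod l)) \<noteq> (inv\<^bsub>racg \<Gamma>\<^esub> (wprod l) \<otimes>\<^bsub>racg \<Gamma>\<^esub> r \<otimes>\<^bsub>racg \<Gamma>\<^esub> wprod l \<in> X)"
    proof (induction arbitrary: r)
      case Nil
      then show ?case using X by (simp add: N_def F_one)
    next
      case (Cons a l)
      then obtain s where s: "s \<in> verts \<Gamma>" "a = ?\<sigma> s" by blast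
      have h: "wprod l \<in> ?C" using Cons.hyps S by (intro wprod_closed) auto
      let ?r = "?\<sigma> s \<otimes>\<^bsub>racg \<Gamma>\<^esub> r \<otimes>\<^bsub>racg \<Gamma>\<^esub> ?\<sigma> s"
      have r: "?r \<in> ?C" using Cons.prems s(1) by (simp add: racg_gen_carrier)
      have step: "F (?\<sigma> s \<otimes>\<^bsub>racg \<Gamma>\<^esub> wprod l) Y = f s (F (wprod l) Y)" if "Y \<in> Pow ?C" for Y
        using F_mult[OF racg_gen_carrier[OF s(1)] h that] F_gen[OF s(1) F_closed[OF h that]] by simp
      have "inv\<^bsub>racg \<Gamma>\<^esub> (?\<sigma> s) = ?\<sigma> s"
        using s(1) by (intro inv_equality) (simp_all add: racg_gen_involution racg_gen_carrier)
      then have "inv\<^bsub>racg \<Gamma>\<^esub> (?\<sigma> s \<otimes>\<^bsub>racg \<Gamma>\<^esub> wprod l) \<otimes>\<^bsub>racg \<Gamma>\<^esub> r \<otimes>\<^bsub>racg \<Gamma>\<^esub> (?\<sigma> s \<otimes>\<^bsub>racg \<Gamma>\<^esub> wprod l)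
          = inv\<^bsub>racg \<Gamma>\<^esub> (wprod l) \<otimes>\<^bsub>racg \<Gamma>\<^esub> ?r \<otimes>\<^bsub>racg \<Gamma>\<^esub> wprod l"
        using s(1) h Cons.prems by (simp add: inv_mult_group m_assoc racg_gen_carrier)
      then show ?case
        using Cons.IH[OF r] step[OF X] step[of "{}"] Cons.prems by (auto simp: N_def f_def s(2))
    qed
    then show ?thesis using l(2) by simp
  qed
  \<comment> \<open>Outside the carrier the action has no specified values, so the cocycle is set to \<open>{}\<close> there.\<close>
  have "wall_group (racg \<Gamma>) ?S (\<lambda>g. if g \<in> ?C then N g else {})"
  proof unfold_locales
    show "?S \<subseteq> ?C" by (rule S)
    show "generate (racg \<Gamma>) ?S = ?C" by (rule racg_generated)
    fix a assume a: "a \<in> ?S"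
    show "a \<otimes>\<^bsub>racg \<Gamma>\<^esub> a = \<one>\<^bsub>racg \<Gamma>\<^esub>" by (rule S_involution[OF a])
    from a obtain s where s: "s \<in> verts \<Gamma>" "a = ?\<sigma> s" by blast
    show "(if a \<in> ?C then N a else {}) = {a}"
      using s F_gen[of s "{}"] racg_gen_carrier[of s] by (auto simp: N_def f_def)
  next
    fix g show "(if g \<in> ?C then N g else {}) \<subseteq> ?C" using N_closed by auto
  next
    fix g h r assume g: "g \<in> ?C" and h: "h \<in> ?C" and r: "r \<in> ?C"
    have "N (g \<otimes>\<^bsub>racg \<Gamma>\<^esub> h) = F g (N h)" using F_mult[OF g h, of "{}"] by (simp add: N_def)
    then show "(r \<in> (if g \<otimes>\<^bsub>racg \<Gamma>\<^esub> h \<in> ?C then N (g \<otimes>\<^bsub>racg \<Gamma>\<^esub> h) else {})) =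
        ((r \<in> (if g \<in> ?C then N g else {})) \<noteq>
         (inv\<^bsub>racg \<Gamma>\<^esub> g \<otimes>\<^bsub>racg \<Gamma>\<^esub> r \<otimes>\<^bsub>racg \<Gamma>\<^esub> g \<in> (if h \<in> ?C then N h else {})))"
      using cocycle[OF g r N_closed[OF h]] g h by simp
  next
    fix a s assume "a \<in> ?S" "s \<in> ?S" "a \<otimes>\<^bsub>racg \<Gamma>\<^esub> s \<noteq> s \<otimes>\<^bsub>racg \<Gamma>\<^esub> a"
    then show "\<exists>F :: 'a word set \<Rightarrow> int \<Rightarrow> int.
        (\<forall>g\<in>?C. \<forall>h\<in>?C. F (g \<otimes>\<^bsub>racg \<Gamma>\<^esub> h) = F g \<circ> F h) \<and> F a = uminus \<and> F s = (\<lambda>x. 1 - x)"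
      by (rule racg_infinite_dihedral)
  qed
  then show ?thesis using that by blast
qed

theorem theorem2:
  fixes \<Gamma> :: "('a, 'b) pre_digraph" and H :: "'a word set set"
  assumes "graph \<Gamma>"
    and "reflection_subgroup \<Gamma> H"
    and "finitely_generated_subgroup (racg \<Gamma>) H"
  shows "quasiconvex (racg \<Gamma>) (racg_gen \<Gamma> ` verts \<Gamma>) H"
proof -
  obtain N where "wall_group (racg \<Gamma>) (racg_gen \<Gamma> ` verts \<Gamma>) N"
    by (rule racg_wall_group)
  then interpret wall_group "racg \<Gamma>" "racg_gen \<Gamma> ` verts \<Gamma>" N .
  have "refls = reflections \<Gamma>" by (auto simp: refls_def reflections_def)
  moreover obtain T where "T \<subseteq> reflections \<Gamma>" "H = generate (racg \<Gamma>) T"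
    using assms(2) by (auto simp: reflection_subgroup_def)
  moreover obtain A where "finite A" "H = generate (racg \<Gamma>) A"
    using assms(3) by (auto simp: finitely_generated_subgroup_def)
  ultimately show ?thesis using reflection_subgroup_quasiconvex[of T A] by simp
qed

end
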